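(* Let $0<\alpha<n$ and $1<p\le q<\infty$, and suppose $$\frac{p'}{q'}\Big(1-\frac{\alpha}{n}\Big)\ge 1.$$ Then for all sufficiently large $\delta>0$ (i.e. there is $\delta_0$, depending only on $\alpha,n,p,q$, such that for every $\delta>\delta_0$) the following holds with $$\Phi(t)=t^q\big(\log(e+t)\big)^{q-1}\big(\log\log(e^e+t)\big)^{q-1+\delta}.$$ For every pair of weights $(u,\sigma)$ that satisfies $$\sup_Q|Q|^{\frac{\alpha}{n}+\frac1q-\frac1p}\,\|u^{\frac1q}\|_{\Phi,Q}\,\|\sigma^{\frac1{p'}}\|_{p',Q}<\infty,$$ there is a constant $C<\infty$ such that for all $f\in L^p(\sigma)$, $$\|I_\alpha(f\sigma)\|_{L^{q,\infty}(u)}\le C\,\|f\|_{L^p(\sigma)}.$$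
   Context: All functions are on $\mathbb{R}^n$; the supremum is over all cubes $Q\subset\mathbb{R}^n$ with sides parallel to the axes. A weight is a non-negative locally integrable function. For $1<r<\infty$, $r'=r/(r-1)$. Riesz potential: $I_\alpha f(x)=\int_{\mathbb{R}^n}\frac{f(y)}{|x-y|^{n-\alpha}}\,dy$. Localized Luxemburg norm: $\|f\|_{\Phi,Q}=\inf\{\lambda>0:\frac1{|Q|}\int_Q\Phi(|f(x)|/\lambda)\,dx\le1\}$; for $1<r<\infty$, $\|f\|_{r,Q}=\big(\frac1{|Q|}\int_Q|f|^r\,dx\big)^{1/r}$. $\|f\|_{L^p(\sigma)}=(\int|f|^p\sigma\,dx)^{1/p}$ and $\|g\|_{L^{q,\infty}(u)}=\sup_{t>0}t\,u(\{x:|g(x)|>t\})^{1/q}$, where $u(E)=\int_E u\,dx$. *)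

theory Defs
  imports "HOL-Analysis.Analysis"
begin

definition conj_exponent :: "real \<Rightarrow> real" where
  "conj_exponent r = r / (r - 1)"

text \<open>Real powers on \<open>[0,\<infinity>]\<close>; only used with exponents \<open>a > 0\<close>, so that
  \<open>\<infinity>\<close> raised to the power \<open>a\<close> is \<open>\<infinity>\<close>.\<close>

definition ennpowr :: "ennreal \<Rightarrow> real \<Rightarrow> ennreal" where
  "ennpowr x a = (if x = \<infinity> then \<infinity> else ennreal (enn2real x powr a))"

definition cubes :: "(real ^ 'n) set set" where
  "cubes = {cbox a (\<chi> i. a $ i + h) | a h. h > 0}"

definition weight :: "(real ^ 'n \<Rightarrow> real) \<Rightarrow> bool" where
  "weight w \<longleftrightarrow> (\<forall>x. 0 \<le> w x) \<and> (\<forall>K. compact K \<longrightarrow> w absolutely_integrable_on K)"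

definition average :: "(real ^ 'n) set \<Rightarrow> (real ^ 'n \<Rightarrow> ennreal) \<Rightarrow> ennreal" where
  "average Q g = (\<integral>\<^sup>+x\<in>Q. g x \<partial>lebesgue) / emeasure lebesgue Q"

text \<open>The infimum is taken in \<open>[0,\<infinity>]\<close>, so the norm is \<open>\<infinity>\<close> if no \<open>\<lambda>\<close> is admissible.\<close>

definition luxemburg_norm ::
    "(real \<Rightarrow> real) \<Rightarrow> (real ^ 'n) set \<Rightarrow> (real ^ 'n \<Rightarrow> real) \<Rightarrow> ennreal" where
  "luxemburg_norm \<Phi> Q f =
     Inf {ennreal l | l. l > 0 \<and> average Q (\<lambda>x. ennreal (\<Phi> (\<bar>f x\<bar> / l))) \<le> 1}"

definition local_norm :: "real \<Rightarrow> (real ^ 'n) set \<Rightarrow> (real ^ 'n \<Rightarrow> real) \<Rightarrow> ennreal" where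
  "local_norm r Q f = ennpowr (average Q (\<lambda>x. ennreal (\<bar>f x\<bar> powr r))) (1 / r)"

text \<open>The integral defining the Riesz potential is taken in the extended reals, as the integral
  of the positive part minus that of the negative part (\<open>ennreal\<close> truncates negative numbers
  to 0). If both are infinite, the integral is undefined and the convention
  \<open>\<infinity> - \<infinity> = \<infinity>\<close> of type \<open>ereal\<close> assigns it the value \<open>\<infinity>\<close>. Points where the
  integral diverges or is undefined therefore lie in every level set \<open>{x. t < \<bar>g x\<bar>}\<close>, and
  a weak-type bound for the potential entails its absolute convergence almost everywhere with
  respect to the weight.\<close>

definition riesz_potential :: "real \<Rightarrow> (real ^ 'n \<Rightarrow> real) \<Rightarrow> real ^ 'n \<Rightarrow> ereal" where
  "riesz_potential \<alpha> f x =
     enn2ereal (\<integral>\<^sup>+y. ennreal (f y / norm (x - y) powr (real CARD('n) - \<alpha>)) \<partial>lebesgue)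
   - enn2ereal (\<integral>\<^sup>+y. ennreal (- (f y / norm (x - y) powr (real CARD('n) - \<alpha>))) \<partial>lebesgue)"

definition weight_measure :: "(real ^ 'n \<Rightarrow> real) \<Rightarrow> (real ^ 'n) set \<Rightarrow> ennreal" where
  "weight_measure u E = (\<integral>\<^sup>+x\<in>E. ennreal (u x) \<partial>lebesgue)"

definition Lp_norm :: "real \<Rightarrow> (real ^ 'n \<Rightarrow> real) \<Rightarrow> (real ^ 'n \<Rightarrow> real) \<Rightarrow> ennreal" where
  "Lp_norm p w f = ennpowr (\<integral>\<^sup>+x. ennreal (\<bar>f x\<bar> powr p * w x) \<partial>lebesgue) (1 / p)"

definition Lp :: "real \<Rightarrow> (real ^ 'n \<Rightarrow> real) \<Rightarrow> (real ^ 'n \<Rightarrow> real) set" where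
  "Lp p w = {f \<in> borel_measurable lebesgue. Lp_norm p w f < \<infinity>}"

definition weak_Lq_norm :: "real \<Rightarrow> (real ^ 'n \<Rightarrow> real) \<Rightarrow> (real ^ 'n \<Rightarrow> ereal) \<Rightarrow> ennreal" where
  "weak_Lq_norm q u g =
     (SUP t\<in>{0<..}. ennreal t * ennpowr (weight_measure u {x. ereal t < \<bar>g x\<bar>}) (1 / q))"

definition loglog_bump :: "real \<Rightarrow> real \<Rightarrow> real \<Rightarrow> real" where
  "loglog_bump q \<delta> t =
     t powr q * ln (exp 1 + t) powr (q - 1) * ln (ln (exp (exp 1) + t)) powr (q - 1 + \<delta>)"

end

theory Submission
  imports Defs
begin

text \<open>
  The exponent condition forces \<open>p < q\<close>, and then \<open>\<delta>\<^sub>0 = 0\<close> works: only the factor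
  \<open>log\<^bsup>q-1\<^esup>\<close> of the bump is used.

  Let \<open>Q\<^sub>j\<close> be the cube of half-side \<open>2\<^bsup>j+1\<^esup>r\<close> about \<open>x\<close>. Splitting at a level of \<open>u\<close>, the
  bump yields \<open>u(Q\<^sub>0)\<^bsup>1/q\<^esup> \<lesssim> (1+j)\<^bsup>-1/q'\<^esup> |Q\<^sub>j|\<^bsup>1/q\<^esup> \<parallel>u\<^bsup>1/q\<^esup>\<parallel>\<^sub>\<Phi>\<close>
  (norm over \<open>Q\<^sub>j\<close>). Since \<open>p'/q' > 1\<close>, the bounds for \<open>\<sigma>(Q\<^sub>j)\<close> can be summed over \<open>j\<close> to the
  tail condition
  \<open>u(B(x,2r))\<^bsup>p'/q\<^esup> \<integral>\<^bsub>|x-y|\<ge>r\<^esub> |x-y|\<^bsup>(\<alpha>-n)p'\<^esup> \<sigma>(y) dy \<le> A\<close>.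

  Given the tail condition, let \<open>\<mu>\<close> be \<open>u\<close> restricted to a bounded part of a level set
  \<open>{I\<^sub>\<alpha>(|f|\<sigma>) > t}\<close>, \<open>W = \<mu>(\<real>\<^sup>n)\<close> and \<open>m(x,y) = \<mu>(B(y,|x-y|)) \<le> \<mu>(B(x,2|x-y|))\<close>. Young's inequality
  with the weight \<open>m\<^sup>\<theta>\<close>, \<open>1/q < \<theta> < 1/p\<close>, separates \<open>|x-y|\<^bsup>\<alpha>-n\<^esup> |f(y)|\<close> into
  \<open>|f|\<^sup>p m\<^bsup>-\<theta>p\<^esup>\<close>, whose \<open>\<mu>\<close>-integral in \<open>x\<close> is \<open>O(W\<^bsup>1-\<theta>p\<^esup>)\<close> because \<open>\<mu>{x. m(x,y) \<le> \<lambda>} \<le> \<lambda>\<close>,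
  and \<open>|x-y|\<^bsup>(\<alpha>-n)p'\<^esup> m\<^bsup>\<theta>p'\<^esup>\<close>, whose \<open>\<sigma>\<close>-integral in \<open>y\<close> is controlled by the tail condition.
  The outcome is \<open>t W \<lesssim> W\<^bsup>1-1/q\<^esup> \<parallel>f\<parallel>\<close>, which is the weak-type bound.
\<close>

section \<open>Layer cake estimates\<close>

text \<open>If \<open>\<rho>\<close> attains its maximum on S, then S lies in the sublevel set
  through a maximizer. Otherwise S is covered by an increasing sequence of sublevel sets through
  points of S whose values approach the supremum. Used below for balls about a point
  (\<open>\<rho>\<close> a distance) and for their complements (\<open>\<rho>\<close> a negated
  distance).\<close>

lemma emeasure_sublevel_closed_le:
  fixes \<rho> :: "'a \<Rightarrow> real"
  assumes \<rho>[measurable]: "\<rho> \<in> borel_measurable \<nu>" and S: "S \<in> sets \<nu>"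
    and le: "\<And>x. x \<in> S \<Longrightarrow> emeasure \<nu> {z \<in> space \<nu>. \<rho> z \<le> \<rho> x} \<le> h"
  shows "emeasure \<nu> S \<le> h"
proof (cases "\<exists>x\<in>S. \<forall>y\<in>S. \<rho> y \<le> \<rho> x")
  case True
  then obtain x where x: "x \<in> S" "\<And>y. y \<in> S \<Longrightarrow> \<rho> y \<le> \<rho> x" by blast
  have "emeasure \<nu> S \<le> emeasure \<nu> {z \<in> space \<nu>. \<rho> z \<le> \<rho> x}"
    using x S sets.sets_into_space[OF S] by (intro emeasure_mono) auto
  with le[OF x(1)] show ?thesis by order
next
  case False
  show ?thesis
  proof (cases "S = {}")
    case False
    then have "(\<lambda>x. ereal (\<rho> x)) ` S \<noteq> {}" by simp
    from Sup_countable_SUP[OF this] obtain F :: "nat \<Rightarrow> ereal"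
      where F: "incseq F" "range F \<subseteq> (\<lambda>x. ereal (\<rho> x)) ` S"
        "Sup ((\<lambda>x. ereal (\<rho> x)) ` S) = (SUP i. F i)" by auto
    then have "\<forall>i. \<exists>x\<in>S. F i = ereal (\<rho> x)" by blast
    then obtain X where X: "\<And>i. X i \<in> S" "\<And>i. F i = ereal (\<rho> (X i))" by metis
    define T where "T = (\<lambda>i. {z \<in> space \<nu>. \<rho> z \<le> \<rho> (X i)})"
    have T: "range T \<subseteq> sets \<nu>" unfolding T_def by auto
    have inc: "incseq T"
      using F(1) unfolding T_def incseq_def X by (auto intro: order_trans)
    have "S \<subseteq> (\<Union>i. T i)"
    proof
      fix x assume x: "x \<in> S"
      then obtain y where y: "y \<in> S" "\<rho> x < \<rho> y"
        using \<open>\<not> (\<exists>x\<in>S. \<forall>y\<in>S. \<rho> y \<le> \<rho> x)\<close> by (meson linorder_not_less)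
      have "ereal (\<rho> y) \<le> (SUP i. F i)"
        unfolding F(3)[symmetric] using y by (intro SUP_upper) auto
      with y(2) have "ereal (\<rho> x) < (SUP i. F i)" by (metis ereal_less_eq(3) less_le_trans linorder_not_less)
      then obtain i where "ereal (\<rho> x) < F i" by (auto simp: less_SUP_iff)
      then show "x \<in> (\<Union>i. T i)"
        using x sets.sets_into_space[OF S] unfolding T_def X by (auto intro!: exI[of _ i])
    qed
    then have "emeasure \<nu> S \<le> emeasure \<nu> (\<Union>i. T i)"
      using T by (intro emeasure_mono) auto
    also have "\<dots> = (SUP i. emeasure \<nu> (T i))"
      using SUP_emeasure_incseq[OF T inc] by simp
    also have "\<dots> \<le> h" using le X unfolding T_def by (intro SUP_least) auto
    finally show ?thesis .
  qed simp
qed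

text \<open>This is \<open>2 powr \<bar>\<gamma>\<bar>\<close> times the geometric series with ratio
  \<open>2 powr (b - \<gamma>)\<close>, which converges for b < \<gamma>.\<close>

definition layer_const :: "real \<Rightarrow> real \<Rightarrow> real" where
  "layer_const \<gamma> b = 2 powr \<bar>\<gamma>\<bar> / (1 - 2 powr (b - \<gamma>))"

lemma layer_const_nonneg: "b < \<gamma> \<Longrightarrow> 0 \<le> layer_const \<gamma> b"
  using powr_less_mono[of "b - \<gamma>" 0 2] by (auto simp: layer_const_def)

lemma dyadic_layer:
  fixes w W :: real
  assumes "0 < w" "w \<le> W"
  shows "\<exists>k::nat. W / 2 ^ k / 2 < w \<and> w \<le> W / 2 ^ k"
proof -
  define k where "k = nat \<lfloor>log 2 (W / w)\<rfloor>"
  have "0 \<le> log 2 (W / w)" using assms by simp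
  then have "real k \<le> log 2 (W / w)" "log 2 (W / w) < real k + 1"
    unfolding k_def by linarith+
  then have "2 powr real k \<le> W / w" "W / w < 2 powr (real k + 1)"
    using assms by (simp_all add: le_log_iff log_less_iff)
  then show ?thesis
    using assms by (intro exI[of _ k]) (simp add: powr_realpow powr_add field_simps)
qed

text \<open>On the dyadic layer l/2 < g <= l with l = W/2^k, the power of g is at most
  \<open>2 powr \<bar>\<gamma>\<bar>\<close> times that of l, whatever the sign of \<gamma>. The
  layer therefore contributes a multiple of l^(\<gamma>-b), and b < \<gamma> makes the sum over k
  geometric.\<close>

lemma nn_integral_powr_layer_le:
  fixes g :: "'a \<Rightarrow> real"
  assumes g[measurable]: "g \<in> borel_measurable \<nu>"
    and g01: "\<And>x. x \<in> space \<nu> \<Longrightarrow> 0 \<le> g x" "\<And>x. x \<in> space \<nu> \<Longrightarrow> g x \<le> W"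
    and W: "0 < W" and B: "0 \<le> B" and b: "b < \<gamma>"
    and layer: "\<And>l. 0 < l \<Longrightarrow> l \<le> W \<Longrightarrow>
        emeasure \<nu> {x \<in> space \<nu>. l / 2 < g x \<and> g x \<le> l} \<le> ennreal (B * l powr - b)"
  shows "(\<integral>\<^sup>+x. ennreal (g x powr \<gamma>) \<partial>\<nu>) \<le> ennreal (layer_const \<gamma> b * B * W powr (\<gamma> - b))"
proof -
  define L where "L = (\<lambda>k::nat. {x \<in> space \<nu>. W / 2 ^ k / 2 < g x \<and> g x \<le> W / 2 ^ k})"
  define c where "c = (\<lambda>k::nat. 2 powr \<bar>\<gamma>\<bar> * (W / 2 ^ k) powr \<gamma>)"
  have L[measurable]: "L k \<in> sets \<nu>" for k unfolding L_def by measurable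
  have pt: "ennreal (g x powr \<gamma>) \<le> (\<Sum>k. ennreal (c k) * indicator (L k) x)" if x: "x \<in> space \<nu>" for x
  \<comment> \<open>Since \<open>0 powr \<gamma> = 0\<close>, the zeros of g contribute nothing,
    even for negative \<gamma>.\<close>
  proof (cases "g x = 0")
    case False
    with g01[OF x] have gx: "0 < g x" "g x \<le> W" by auto
    from dyadic_layer[OF this] obtain k :: nat where k: "W / 2 ^ k / 2 < g x" "g x \<le> W / 2 ^ k"
      by blast
    define l where "l = W / 2 ^ k"
    have l: "0 < l" "l / 2 < g x" "g x \<le> l" using k W by (auto simp: l_def)
    have "g x powr \<gamma> \<le> 2 powr \<bar>\<gamma>\<bar> * l powr \<gamma>"
    proof (cases "0 \<le> \<gamma>")
      case True
      then have "g x powr \<gamma> \<le> 1 * l powr \<gamma>" using l gx by (simp add: powr_mono2)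
      also have "\<dots> \<le> 2 powr \<bar>\<gamma>\<bar> * l powr \<gamma>"
        by (intro mult_right_mono ge_one_powr_ge_zero) auto
      finally show ?thesis .
    next
      case False
      then have "g x powr \<gamma> \<le> (l / 2) powr \<gamma>" using l gx by (intro powr_mono2') auto
      also have "\<dots> = 2 powr \<bar>\<gamma>\<bar> * l powr \<gamma>"
        using False l by (simp add: powr_divide powr_minus divide_simps)
      finally show ?thesis .
    qed
    then have "ennreal (g x powr \<gamma>) \<le> ennreal (c k) * indicator (L k) x"
      using k x by (auto simp: c_def L_def l_def intro!: ennreal_leI)
    also have "\<dots> \<le> (\<Sum>k. ennreal (c k) * indicator (L k) x)"
      using sum_le_suminf[of "\<lambda>k. ennreal (c k) * indicator (L k) x" "{k}"]
      by (auto simp del: sum_mult_indicator)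
    finally show ?thesis .
  qed simp
  have geo: "2 powr (b - \<gamma>) < 1" using powr_less_mono[of "b - \<gamma>" 0 2] b by simp
  have ck: "c k * (B * (W / 2 ^ k) powr - b)
      = 2 powr \<bar>\<gamma>\<bar> * B * W powr (\<gamma> - b) * (2 powr (b - \<gamma>)) ^ k" for k
  proof -
    have "(W / 2 ^ k) powr \<gamma> * (W / 2 ^ k) powr - b = (W / 2 ^ k) powr (\<gamma> - b)"
      by (simp add: powr_add[symmetric])
    also have "\<dots> = W powr (\<gamma> - b) * (2 powr (b - \<gamma>)) ^ k"
    proof -
      have "(W / 2 ^ k) powr (\<gamma> - b) = W powr (\<gamma> - b) / 2 powr (real k * (\<gamma> - b))"
        by (simp add: powr_divide powr_realpow[symmetric] powr_powr)
      also have "\<dots> = W powr (\<gamma> - b) * 2 powr ((b - \<gamma>) * real k)"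
        unfolding divide_powr_uminus by (simp add: algebra_simps)
      finally show ?thesis by (simp add: powr_realpow[symmetric] powr_powr)
    qed
    finally show ?thesis by (simp add: c_def algebra_simps)
  qed
  have "(\<integral>\<^sup>+x. ennreal (g x powr \<gamma>) \<partial>\<nu>) \<le> (\<integral>\<^sup>+x. (\<Sum>k. ennreal (c k) * indicator (L k) x) \<partial>\<nu>)"
    by (intro nn_integral_mono pt)
  also have "\<dots> = (\<Sum>k. ennreal (c k) * emeasure \<nu> (L k))"
    by (subst nn_integral_suminf) (auto simp: nn_integral_cmult_indicator)
  also have "\<dots> \<le> (\<Sum>k. ennreal (2 powr \<bar>\<gamma>\<bar> * B * W powr (\<gamma> - b) * (2 powr (b - \<gamma>)) ^ k))"
  proof (intro suminf_le allI summableI)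
    fix k :: nat
    have "emeasure \<nu> (L k) \<le> ennreal (B * (W / 2 ^ k) powr - b)"
      unfolding L_def using W by (intro layer) (auto simp: divide_simps mult_le_cancel_left1)
    then have "ennreal (c k) * emeasure \<nu> (L k) \<le> ennreal (c k) * ennreal (B * (W / 2 ^ k) powr - b)"
      by (rule mult_left_mono) simp
    also have "\<dots> = ennreal (c k * (B * (W / 2 ^ k) powr - b))"
      using B by (simp add: c_def ennreal_mult)
    finally show "ennreal (c k) * emeasure \<nu> (L k)
      \<le> ennreal (2 powr \<bar>\<gamma>\<bar> * B * W powr (\<gamma> - b) * (2 powr (b - \<gamma>)) ^ k)" by (simp only: ck)
  qed
  also have "\<dots> = ennreal (\<Sum>k. 2 powr \<bar>\<gamma>\<bar> * B * W powr (\<gamma> - b) * (2 powr (b - \<gamma>)) ^ k)"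
    using B geo by (intro suminf_ennreal2) (auto intro!: summable_mult summable_geometric)
  also have "(\<Sum>k. 2 powr \<bar>\<gamma>\<bar> * B * W powr (\<gamma> - b) * (2 powr (b - \<gamma>)) ^ k)
      = layer_const \<gamma> b * B * W powr (\<gamma> - b)"
    using geo by (simp add: suminf_mult summable_geometric suminf_geometric layer_const_def)
  finally show ?thesis .
qed

section \<open>A bilinear estimate for kernels of the distance\<close>

lemma conj_gt_one:
  fixes p s :: real
  assumes "1 < p" "1 / p + 1 / s = 1"
  shows "1 < s"
proof -
  have "1 / s = (p - 1) / p" using assms by (simp add: field_simps)
  moreover have "0 < (p - 1) / p" "(p - 1) / p < 1" using assms by auto
  ultimately have "0 < 1 / s" "1 / s < 1" by metis+
  then show ?thesis by (simp add: field_simps split: if_splits)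
qed

text \<open>To be applied with \<open>\<mu>\<close> the weight u on a bounded part of a level set
  and \<open>\<tau>\<close> the measure \<sigma> dy. The two bounds on \<theta> serve the two halves
  of Young's inequality: \<theta> < 1/p makes m^(-\<theta>p) integrable for \<open>\<mu>\<close>,
  and \<theta> > 1/q lets the tail bound be summed over the layers of m^(\<theta>s). The interval
  for \<theta> is nonempty because p < q.\<close>

lemma bilinear_form_le:
  fixes \<mu> \<tau> :: "'a::{metric_space,second_countable_topology} measure"
    and k :: "real \<Rightarrow> real" and f :: "'a \<Rightarrow> real"
  assumes "finite_measure \<mu>" "sigma_finite_measure \<tau>"
    and sp: "space \<mu> = UNIV" "space \<tau> = UNIV"
    and id[measurable]: "(\<lambda>x. x) \<in> measurable \<mu> borel" "(\<lambda>x. x) \<in> measurable \<tau> borel"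
    and k[measurable]: "k \<in> borel_measurable borel" and k_nonneg: "\<And>t. 0 \<le> k t" and k0: "k 0 = 0"
    and f[measurable]: "f \<in> borel_measurable \<tau>" and f_nonneg: "\<And>y. 0 \<le> f y"
    and f_norm: "(\<integral>\<^sup>+y. ennreal (f y powr p) \<partial>\<tau>) \<le> 1"
    and pq: "1 < p" "p < q" and s: "1 / p + 1 / s = 1"
    and A: "0 \<le> A"
    and tail: "\<And>x r. 0 < r \<Longrightarrow> ennreal (measure \<mu> {z. dist x z \<le> 2 * r} powr (s / q))
        * (\<integral>\<^sup>+y\<in>{y. r \<le> dist x y}. ennreal (k (dist x y) powr s) \<partial>\<tau>) \<le> ennreal A"
    and W: "0 < measure \<mu> UNIV"
    and \<theta>: "1 / q < \<theta>" "\<theta> < 1 / p"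
  shows "(\<integral>\<^sup>+x. \<integral>\<^sup>+y. ennreal (k (dist x y) * f y) \<partial>\<tau> \<partial>\<mu>)
    \<le> ennreal ((layer_const (- \<theta> * p) (- 1) + layer_const (\<theta> * s) (s / q) * (A * 2 powr (s / q)))
        * measure \<mu> UNIV powr (1 - 1 / q))"
proof -
  interpret \<mu>: finite_measure \<mu> by fact
  interpret \<tau>: sigma_finite_measure \<tau> by fact
  interpret pair_sigma_finite \<mu> \<tau> ..
  define W where "W = measure \<mu> UNIV"
  \<comment> \<open>The ball of m is centred at y, which gives sublevel bounds in x for fixed y. The
    ball of H is centred at x, which matches the tail hypothesis for fixed x. The triangle
    inequality yields m <= H, and this is where the radius 2r of that hypothesis comes from.\<close>
  define m where "m = (\<lambda>x y. measure \<mu> {z. dist z y \<le> dist x y})"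
  define H where "H = (\<lambda>x y. measure \<mu> {z. dist x z \<le> 2 * dist x y})"
  define b where "b = s / q"
  define C1 where "C1 = layer_const (- \<theta> * p) (- 1) * W powr (1 - \<theta> * p)"
  define C2 where "C2 = layer_const (\<theta> * s) b * (A * 2 powr b) * W powr (\<theta> * s - b)"
  have s1: "1 < s" using conj_gt_one[OF pq(1) s] .
  have W0: "0 < W" using W by (simp add: W_def)
  have \<theta>0: "0 < \<theta>" using \<theta> pq by (smt (verit) divide_pos_pos)
  have \<theta>p: "\<theta> * p < 1" and b\<theta>: "b < \<theta> * s" and b0: "0 < b"
    using \<theta> pq s1 by (auto simp: b_def field_simps)
  \<comment> \<open>As an integral of a jointly measurable integrand, m is measurable in the pair
    (x,y); likewise H below.\<close>
  have m_eq: "m x y = enn2real (\<integral>\<^sup>+z. (if dist z y \<le> dist x y then 1 else 0) \<partial>\<mu>)" for x y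
  proof -
    have "(\<integral>\<^sup>+z. (if dist z y \<le> dist x y then 1 else 0) \<partial>\<mu>)
        = (\<integral>\<^sup>+z. indicator {z \<in> space \<mu>. dist z y \<le> dist x y} z \<partial>\<mu>)"
      by (intro nn_integral_cong) (auto simp: indicator_def)
    also have "\<dots> = emeasure \<mu> {z \<in> space \<mu>. dist z y \<le> dist x y}"
      by (intro nn_integral_indicator) measurable
    finally show ?thesis by (simp add: m_def measure_def sp)
  qed
  have H_eq: "H x y = enn2real (\<integral>\<^sup>+z. (if dist x z \<le> 2 * dist x y then 1 else 0) \<partial>\<mu>)" for x y
  proof -
    have "(\<integral>\<^sup>+z. (if dist x z \<le> 2 * dist x y then 1 else 0) \<partial>\<mu>)
        = (\<integral>\<^sup>+z. indicator {z \<in> space \<mu>. dist x z \<le> 2 * dist x y} z \<partial>\<mu>)"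
      by (intro nn_integral_cong) (auto simp: indicator_def)
    also have "\<dots> = emeasure \<mu> {z \<in> space \<mu>. dist x z \<le> 2 * dist x y}"
      by (intro nn_integral_indicator) measurable
    finally show ?thesis by (simp add: H_def measure_def sp)
  qed
  have m_meas[measurable]: "(\<lambda>(x, y). m x y) \<in> borel_measurable (\<mu> \<Otimes>\<^sub>M \<tau>)"
    unfolding m_eq by measurable
  have H_meas[measurable]: "(\<lambda>(x, y). H x y) \<in> borel_measurable (\<mu> \<Otimes>\<^sub>M \<tau>)"
    unfolding H_eq by measurable
  have m_meas1[measurable]: "(\<lambda>x. m x y) \<in> borel_measurable \<mu>" for y
    unfolding m_eq by measurable
  have H_meas1[measurable]: "(\<lambda>y. H x y) \<in> borel_measurable \<tau>" for x
    unfolding H_eq by measurable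
  have d_meas[measurable]: "(\<lambda>x. dist x y) \<in> borel_measurable \<mu>" "(\<lambda>x. dist y x) \<in> borel_measurable \<tau>"
     "(\<lambda>x. dist y x) \<in> borel_measurable \<mu>" for y
    by measurable
  have in_sets[measurable]: "{z. dist z y \<le> r} \<in> sets \<mu>" "{z. dist y z \<le> r} \<in> sets \<mu>"
     "{z. r \<le> dist y z} \<in> sets \<tau>" for y r
  proof -
    have "{z \<in> space \<mu>. dist z y \<le> r} \<in> sets \<mu>" "{z \<in> space \<mu>. dist y z \<le> r} \<in> sets \<mu>"
      "{z \<in> space \<tau>. r \<le> dist y z} \<in> sets \<tau>"
      by measurable
    then show "{z. dist z y \<le> r} \<in> sets \<mu>" "{z. dist y z \<le> r} \<in> sets \<mu>" "{z. r \<le> dist y z} \<in> sets \<tau>"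
      by (simp_all add: sp)
  qed
  have m_le_H: "m x y \<le> H x y" for x y
    unfolding m_def H_def
  proof (rule \<mu>.finite_measure_mono)
    show "{z. dist z y \<le> dist x y} \<subseteq> {z. dist x z \<le> 2 * dist x y}"
    proof safe
      fix z assume "dist z y \<le> dist x y"
      then show "dist x z \<le> 2 * dist x y" using dist_triangle2[of x z y] by linarith
    qed
  qed simp
  have m_nonneg: "0 \<le> m x y" and H_nonneg: "0 \<le> H x y" and m_le_W: "m x y \<le> W" and H_le_W: "H x y \<le> W"
    for x y using \<mu>.bounded_measure sp by (auto simp: m_def H_def W_def)

  \<comment> \<open>For fixed y, a closed ball about y through a point x of the set has mass m(x,y)
    <= l, so the sublevel lemma bounds the whole set. The predicate P covers both the dyadic layers
    and the zero set of m.\<close>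
  have sub: "emeasure \<mu> {x \<in> space \<mu>. P (m x y)} \<le> ennreal l"
    if P: "\<And>t. P t \<Longrightarrow> t \<le> l" and [measurable]: "Measurable.pred borel P" and "0 \<le> l" for P l y
  proof (rule emeasure_sublevel_closed_le[where \<rho> = "\<lambda>z. dist z y"])
    fix x assume "x \<in> {x \<in> space \<mu>. P (m x y)}"
    then show "emeasure \<mu> {z \<in> space \<mu>. dist z y \<le> dist x y} \<le> ennreal l"
      using P[of "m x y"] unfolding m_def by (simp add: \<mu>.emeasure_eq_measure sp ennreal_leI)
  qed measurable
  \<comment> \<open>Layer estimate with \<gamma> = -\<theta>p, b = -1 and B = 1; the condition b <
    \<gamma> reads \<theta>p < 1.\<close>
  have I1: "(\<integral>\<^sup>+x. ennreal (m x y powr (- \<theta> * p)) \<partial>\<mu>) \<le> ennreal C1" for y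
  proof -
    have "(\<integral>\<^sup>+x. ennreal (m x y powr (- \<theta> * p)) \<partial>\<mu>)
      \<le> ennreal (layer_const (- \<theta> * p) (- 1) * 1 * W powr (- \<theta> * p - - 1))"
    proof (rule nn_integral_powr_layer_le)
      fix l :: real assume "0 < l" "l \<le> W"
      then show "emeasure \<mu> {x \<in> space \<mu>. l / 2 < m x y \<and> m x y \<le> l} \<le> ennreal (1 * l powr - (- 1))"
        using sub[of "\<lambda>t. l / 2 < t \<and> t \<le> l" l y] by simp
    qed (use m_nonneg m_le_W W0 \<theta>p in auto)
    then show ?thesis by (simp add: C1_def add.commute)
  qed
  \<comment> \<open>Young's inequality is weighted by a negative power of m, so the points with m =
    0 must be discarded. They form a \<open>\<mu>\<close>-null set for each y.\<close>
  have m_pos: "AE x in \<mu>. m x y \<noteq> 0" for y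
  proof -
    have "emeasure \<mu> {x \<in> space \<mu>. m x y = 0} \<le> ennreal 0"
      by (rule sub) auto
    then have "{x \<in> space \<mu>. m x y = 0} \<in> null_sets \<mu>" by (auto intro!: null_setsI)
    then show ?thesis by (auto intro: AE_I')
  qed
  \<comment> \<open>Layer estimate with \<gamma> = \<theta>s and b = s/q for the measure with
    density k(|x-y|)^s; here b < \<gamma> reads \<theta> > 1/q.\<close>
  have I2: "(\<integral>\<^sup>+y. ennreal (k (dist x y) powr s * H x y powr (\<theta> * s)) \<partial>\<tau>) \<le> ennreal C2" for x
  proof -
    define \<nu> where "\<nu> = density \<tau> (\<lambda>y. ennreal (k (dist x y) powr s))"
    have \<nu>[simp]: "space \<nu> = UNIV" "sets \<nu> = sets \<tau>" by (auto simp: \<nu>_def sp)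
    have g: "(\<lambda>y. H x y) \<in> borel_measurable \<nu>"
      by (simp add: measurable_cong_sets[OF \<nu>(2) refl] H_meas1)
    have "(\<integral>\<^sup>+y. ennreal (k (dist x y) powr s * H x y powr (\<theta> * s)) \<partial>\<tau>)
        = (\<integral>\<^sup>+y. ennreal (H x y powr (\<theta> * s)) \<partial>\<nu>)"
      unfolding \<nu>_def by (subst nn_integral_density) (auto simp: ennreal_mult)
    also have "\<dots> \<le> ennreal (layer_const (\<theta> * s) b * (A * 2 powr b) * W powr (\<theta> * s - b))"
    proof (rule nn_integral_powr_layer_le)
      fix l :: real assume l: "0 < l" "l \<le> W"
      define S where "S = {y \<in> space \<tau>. l / 2 < H x y \<and> H x y \<le> l}"
      \<comment> \<open>The tail hypothesis needs a positive radius, so y = x is removed; it carries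
        no mass because \<open>k 0 = 0\<close>.\<close>
      define S' where "S' = {y \<in> space \<tau>. 0 < dist x y \<and> l / 2 < H x y \<and> H x y \<le> l}"
      have [measurable]: "S \<in> sets \<tau>" "S' \<in> sets \<tau>" unfolding S_def S'_def by measurable
      have "emeasure \<nu> S = emeasure \<nu> S'"
        unfolding \<nu>_def by (simp add: emeasure_density, intro nn_integral_cong)
          (auto simp: S_def S'_def indicator_def k0)
      also have "\<dots> \<le> ennreal (A * 2 powr b * l powr - b)"
      \<comment> \<open>With the negated distance the sublevel set through y is the complement of
        the open ball of radius |x-y| about x. The tail hypothesis applies to it, and H > l/2 on the
        layer turns its bound into A (l/2)^(-b).\<close>
      proof (rule emeasure_sublevel_closed_le[where \<rho> = "\<lambda>y. - dist x y"])
        show "(\<lambda>y. - dist x y) \<in> borel_measurable \<nu>"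
          by (simp add: measurable_cong_sets[OF \<nu>(2) refl])
        fix y assume y: "y \<in> S'"
        define I where "I = (\<integral>\<^sup>+z\<in>{z. dist x y \<le> dist x z}. ennreal (k (dist x z) powr s) \<partial>\<tau>)"
        have Hb: "(l / 2) powr b \<le> H x y powr b"
          using y l b0 by (intro powr_mono2) (auto simp: S'_def)
        have "ennreal ((l / 2) powr b) * I \<le> ennreal (H x y powr b) * I"
          using Hb by (intro mult_right_mono ennreal_leI) auto
        also have "\<dots> \<le> ennreal A"
          using tail[of "dist x y" x] y unfolding H_def b_def I_def S'_def by auto
        finally have *: "ennreal ((l / 2) powr b) * I \<le> ennreal A" .
        have "I = ennreal ((l / 2) powr - b) * (ennreal ((l / 2) powr b) * I)"
          using l by (simp add: mult.assoc[symmetric] ennreal_mult[symmetric] powr_add[symmetric])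
        also have "\<dots> \<le> ennreal ((l / 2) powr - b) * ennreal A"
          using * by (rule mult_left_mono) simp
        also have "\<dots> = ennreal (A * 2 powr b * l powr - b)"
          using A l by (simp add: ennreal_mult[symmetric] powr_divide powr_minus field_simps)
        finally show "emeasure \<nu> {z \<in> space \<nu>. - dist x z \<le> - dist x y} \<le> ennreal (A * 2 powr b * l powr - b)"
          unfolding I_def by (simp add: \<nu>_def emeasure_density sp)
      qed simp
      finally show "emeasure \<nu> {y \<in> space \<nu>. l / 2 < H x y \<and> H x y \<le> l} \<le> ennreal (A * 2 powr b * l powr - b)"
        by (simp add: S_def sp)
    qed (use g H_nonneg H_le_W W0 A b\<theta> in auto)
    finally show ?thesis by (simp add: C2_def)
  qed

  \<comment> \<open>The exponent is chosen so that both halves of Young's inequality end with the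
    same power: c^p W^(1-\<theta>p) and c^(-s) W^(\<theta>s-b) W both equal W^(1-1/q).\<close>
  define c where "c = W powr (\<theta> - 1 / (p * q))"
  have c0: "0 < c" using W0 by (simp add: c_def)
  have young: "k (dist x y) * f y \<le> c powr p * f y powr p * m x y powr (- \<theta> * p)
      + c powr - s * (k (dist x y) powr s * H x y powr (\<theta> * s))" if "m x y \<noteq> 0" for x y
  proof -
    have m0: "0 < m x y" using that m_nonneg[of x y] by simp
    define a1 where "a1 = c * f y * m x y powr - \<theta>"
    define a2 where "a2 = k (dist x y) * m x y powr \<theta> / c"
    have nn: "0 \<le> a1" "0 \<le> a2" using c0 f_nonneg k_nonneg by (auto simp: a1_def a2_def)
    have "k (dist x y) * f y = a1 * a2"
      using m0 c0 by (simp add: a1_def a2_def powr_minus)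
    also have "\<dots> \<le> a1 powr p / p + a2 powr s / s"
      using pq s s1 nn by (intro Youngs_inequality) auto
    also have "\<dots> \<le> a1 powr p + a2 powr s"
      using pq s1 by (intro add_mono) (auto simp: divide_simps mult_le_cancel_left1)
    also have "a1 powr p = c powr p * f y powr p * m x y powr (- \<theta> * p)"
      using c0 f_nonneg by (simp add: a1_def powr_mult powr_powr)
    also have "a2 powr s = c powr - s * (k (dist x y) powr s * m x y powr (\<theta> * s))"
      using c0 k_nonneg by (simp add: a2_def powr_mult powr_divide powr_powr powr_minus divide_simps)
    also have "\<dots> \<le> c powr - s * (k (dist x y) powr s * H x y powr (\<theta> * s))"
      using m0 m_le_H \<theta>0 s1 by (intro mult_left_mono powr_mono2) auto
    finally show ?thesis by simp
  qed
  define G1 where "G1 = (\<lambda>x y. ennreal (c powr p * f y powr p) * ennreal (m x y powr (- \<theta> * p)))"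
  define G2 where "G2 = (\<lambda>x y. ennreal (c powr - s) * ennreal (k (dist x y) powr s * H x y powr (\<theta> * s)))"
  have [measurable]: "(\<lambda>(x, y). G1 x y) \<in> borel_measurable (\<mu> \<Otimes>\<^sub>M \<tau>)" "(\<lambda>(x, y). G2 x y) \<in> borel_measurable (\<mu> \<Otimes>\<^sub>M \<tau>)"
    unfolding G1_def G2_def by measurable
  have [measurable]: "(\<lambda>x. G1 x y) \<in> borel_measurable \<mu>" "(\<lambda>x. G2 x y) \<in> borel_measurable \<mu>" if "y \<in> space \<tau>" for y
    using that by measurable
  have nn1: "0 \<le> c powr p * C1"
    using \<theta>p by (simp add: C1_def layer_const_nonneg)
  have nn2: "0 \<le> C2" using b\<theta> A by (simp add: C2_def layer_const_nonneg)
  \<comment> \<open>\<open>G1\<close> is integrated in x first, uniformly in y, and then uses the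
    normalization of f. \<open>G2\<close> is integrated in y first, uniformly in x, and then costs
    the total mass W.\<close>
  have T1: "(\<integral>\<^sup>+y. \<integral>\<^sup>+x. G1 x y \<partial>\<mu> \<partial>\<tau>) \<le> ennreal (c powr p * C1)"
  proof -
    have "(\<integral>\<^sup>+y. \<integral>\<^sup>+x. G1 x y \<partial>\<mu> \<partial>\<tau>) \<le> (\<integral>\<^sup>+y. ennreal (c powr p * C1) * ennreal (f y powr p) \<partial>\<tau>)"
    proof (rule nn_integral_mono)
      fix y
      have "(\<integral>\<^sup>+x. G1 x y \<partial>\<mu>) = ennreal (c powr p * f y powr p) * (\<integral>\<^sup>+x. ennreal (m x y powr (- \<theta> * p)) \<partial>\<mu>)"
        unfolding G1_def by (rule nn_integral_cmult) measurable
      also have "\<dots> \<le> ennreal (c powr p * f y powr p) * ennreal C1"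
        by (rule mult_left_mono[OF I1]) simp
      also have "\<dots> = ennreal (c powr p * C1) * ennreal (f y powr p)"
        using nn1 \<theta>p by (subst (1 2) ennreal_mult[symmetric]) (auto simp: C1_def layer_const_nonneg ac_simps)
      finally show "(\<integral>\<^sup>+x. G1 x y \<partial>\<mu>) \<le> ennreal (c powr p * C1) * ennreal (f y powr p)" .
    qed
    also have "\<dots> = ennreal (c powr p * C1) * (\<integral>\<^sup>+y. ennreal (f y powr p) \<partial>\<tau>)"
      by (rule nn_integral_cmult) measurable
    also have "\<dots> \<le> ennreal (c powr p * C1) * 1"
      by (rule mult_left_mono[OF f_norm]) simp
    finally show ?thesis by simp
  qed
  have T2: "(\<integral>\<^sup>+y. \<integral>\<^sup>+x. G2 x y \<partial>\<mu> \<partial>\<tau>) \<le> ennreal (c powr - s * C2 * W)"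
  proof -
    have "(\<integral>\<^sup>+y. \<integral>\<^sup>+x. G2 x y \<partial>\<mu> \<partial>\<tau>) = (\<integral>\<^sup>+x. \<integral>\<^sup>+y. G2 x y \<partial>\<tau> \<partial>\<mu>)"
      by (rule Fubini') measurable
    also have "\<dots> \<le> (\<integral>\<^sup>+x. ennreal (c powr - s * C2) \<partial>\<mu>)"
    proof (rule nn_integral_mono)
      fix x
      have "(\<integral>\<^sup>+y. G2 x y \<partial>\<tau>) = ennreal (c powr - s) * (\<integral>\<^sup>+y. ennreal (k (dist x y) powr s * H x y powr (\<theta> * s)) \<partial>\<tau>)"
        unfolding G2_def by (rule nn_integral_cmult) measurable
      also have "\<dots> \<le> ennreal (c powr - s) * ennreal C2"
        by (rule mult_left_mono[OF I2]) simp
      also have "\<dots> = ennreal (c powr - s * C2)"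
        using nn2 by (simp add: ennreal_mult)
      finally show "(\<integral>\<^sup>+y. G2 x y \<partial>\<tau>) \<le> ennreal (c powr - s * C2)" .
    qed
    also have "\<dots> = ennreal (c powr - s * C2) * ennreal W"
      by (simp add: \<mu>.emeasure_eq_measure sp W_def)
    also have "\<dots> = ennreal (c powr - s * C2 * W)"
      using nn2 W0 by (intro ennreal_mult[symmetric]) auto
    finally show ?thesis .
  qed
  have "(\<integral>\<^sup>+x. \<integral>\<^sup>+y. ennreal (k (dist x y) * f y) \<partial>\<tau> \<partial>\<mu>)
      = (\<integral>\<^sup>+y. \<integral>\<^sup>+x. ennreal (k (dist x y) * f y) \<partial>\<mu> \<partial>\<tau>)"
    by (rule Fubini'[symmetric]) measurable
  also have "\<dots> \<le> (\<integral>\<^sup>+y. (\<integral>\<^sup>+x. G1 x y \<partial>\<mu>) + (\<integral>\<^sup>+x. G2 x y \<partial>\<mu>) \<partial>\<tau>)"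
  proof (rule nn_integral_mono)
    fix y assume [measurable]: "y \<in> space \<tau>"
    have "(\<integral>\<^sup>+x. ennreal (k (dist x y) * f y) \<partial>\<mu>) \<le> (\<integral>\<^sup>+x. G1 x y + G2 x y \<partial>\<mu>)"
    proof (rule nn_integral_mono_AE)
      show "AE x in \<mu>. ennreal (k (dist x y) * f y) \<le> G1 x y + G2 x y"
        using m_pos[of y]
      proof eventually_elim
        case (elim x)
        have "G1 x y + G2 x y = ennreal (c powr p * f y powr p * m x y powr (- \<theta> * p)
            + c powr - s * (k (dist x y) powr s * H x y powr (\<theta> * s)))"
          unfolding G1_def G2_def
          by (subst (1 2) ennreal_mult[symmetric]) (auto intro!: ennreal_plus[symmetric])
        then show ?case by (simp only: ennreal_leI[OF young[OF elim]])
      qed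
    qed
    also have "\<dots> = (\<integral>\<^sup>+x. G1 x y \<partial>\<mu>) + (\<integral>\<^sup>+x. G2 x y \<partial>\<mu>)"
      by (rule nn_integral_add) measurable
    finally show "(\<integral>\<^sup>+x. ennreal (k (dist x y) * f y) \<partial>\<mu>) \<le> (\<integral>\<^sup>+x. G1 x y \<partial>\<mu>) + (\<integral>\<^sup>+x. G2 x y \<partial>\<mu>)" .
  qed
  also have "\<dots> = (\<integral>\<^sup>+y. \<integral>\<^sup>+x. G1 x y \<partial>\<mu> \<partial>\<tau>) + (\<integral>\<^sup>+y. \<integral>\<^sup>+x. G2 x y \<partial>\<mu> \<partial>\<tau>)"
    by (rule nn_integral_add) measurable
  also have "\<dots> \<le> ennreal (c powr p * C1) + ennreal (c powr - s * C2 * W)"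
    by (rule add_mono[OF T1 T2])
  also have "\<dots> = ennreal (c powr p * C1 + c powr - s * C2 * W)"
    using nn1 nn2 W0 by (intro ennreal_plus[symmetric]) auto
  also have "c powr p * C1 + c powr - s * C2 * W
     = (layer_const (- \<theta> * p) (- 1) + layer_const (\<theta> * s) b * (A * 2 powr b)) * W powr (1 - 1 / q)"
  proof -
    have "c powr p * W powr (1 - \<theta> * p) = W powr ((\<theta> - 1 / (p * q)) * p + (1 - \<theta> * p))"
      by (simp add: c_def powr_powr powr_add)
    also have "(\<theta> - 1 / (p * q)) * p + (1 - \<theta> * p) = 1 - 1 / q"
      using pq by (simp add: field_simps)
    finally have e1: "c powr p * W powr (1 - \<theta> * p) = W powr (1 - 1 / q)" .
    have "c powr - s * W powr (\<theta> * s - b) * W = W powr (- (\<theta> - 1 / (p * q)) * s + (\<theta> * s - b) + 1)"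
    proof -
      have "c powr - s = W powr (- (\<theta> - 1 / (p * q)) * s)" 
        unfolding c_def powr_powr by (rule arg_cong[of _ _ "(powr) W"]) (simp add: algebra_simps)
      then show ?thesis using W0 by (simp only: powr_add powr_one less_imp_le)
    qed
    also have "- (\<theta> - 1 / (p * q)) * s + (\<theta> * s - b) + 1 = 1 - 1 / q"
    proof -
      have "s / p = s - 1" using s s1 pq by (simp add: field_simps)
      then have "s / (p * q) = (s - 1) / q" by (metis divide_divide_eq_left)
      then show ?thesis unfolding b_def by (simp add: algebra_simps diff_divide_distrib)
    qed
    finally have e2: "c powr - s * W powr (\<theta> * s - b) * W = W powr (1 - 1 / q)" .
    have "c powr p * C1 + c powr - s * C2 * W
      = layer_const (- \<theta> * p) (- 1) * (c powr p * W powr (1 - \<theta> * p))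
       + layer_const (\<theta> * s) b * (A * 2 powr b) * (c powr - s * W powr (\<theta> * s - b) * W)"
      by (simp add: C1_def C2_def algebra_simps)
    then show ?thesis unfolding e1 e2 by (simp add: algebra_simps)
  qed
  finally show ?thesis by (simp add: W_def b_def)
qed

section \<open>From the tail condition to level sets\<close>

lemma sigma_finite_lebesgue: "sigma_finite_measure (lebesgue :: 'a::euclidean_space measure)"
proof (rule sigma_finite_measure.intro)
  obtain A :: "'a set set" where "countable A" "A \<subseteq> sets lborel" "\<Union>A = space lborel" "\<forall>a\<in>A. emeasure lborel a \<noteq> \<infinity>"
    using lborel.sigma_finite_countable by blast
  then show "\<exists>A::'a set set. countable A \<and> A \<subseteq> sets lebesgue \<and> \<Union>A = space lebesgue \<and> (\<forall>a\<in>A. emeasure lebesgue a \<noteq> \<infinity>)"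
    by (intro exI[of _ A]) (auto simp: subset_iff)
qed

lemma id_lebesgue_borel: "(\<lambda>x. x) \<in> measurable lebesgue borel"
  by (simp add: measurable_completion)

text \<open>The absolute value keeps the integrand nonnegative, so the integral exists in
  [0,\<infinity>]. For the Riesz kernel it dominates the absolute value of the Riesz
  potential.\<close>

definition kernel_potential :: "(real \<Rightarrow> real) \<Rightarrow> ('a::euclidean_space \<Rightarrow> real) \<Rightarrow> 'a \<Rightarrow> ennreal" where
  "kernel_potential k g x = (\<integral>\<^sup>+y. ennreal (k (dist x y) * \<bar>g y\<bar>) \<partial>lebesgue)"

text \<open>On the level set the potential exceeds t, so its integral against \<open>\<mu>\<close>
  is at least tW, while the bilinear estimate bounds it by C W^(1-1/q). Dividing by a power of W
  requires W to be finite, hence the level set is first cut by balls; the bound does not depend on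
  the ball, and monotone convergence removes it.\<close>

lemma level_set_weight_le:
  fixes u \<sigma> f :: "'a::euclidean_space \<Rightarrow> real" and k :: "real \<Rightarrow> real"
  assumes u[measurable]: "u \<in> borel_measurable lebesgue" and u_nonneg: "\<And>x. 0 \<le> u x"
    and u_fin: "\<And>x r. (\<integral>\<^sup>+z\<in>cball x r. ennreal (u z) \<partial>lebesgue) < \<infinity>"
    and \<sigma>[measurable]: "\<sigma> \<in> borel_measurable lebesgue" and \<sigma>_nonneg: "\<And>x. 0 \<le> \<sigma> x"
    and k[measurable]: "k \<in> borel_measurable borel" and k_nonneg: "\<And>t. 0 \<le> k t" and k0: "k 0 = 0"
    and pq: "1 < p" "p < q" and s: "1 / p + 1 / s = 1" and A: "0 \<le> A"
    and tail: "\<And>x r. 0 < r \<Longrightarrow>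
        ennreal (enn2real (\<integral>\<^sup>+z\<in>cball x (2 * r). ennreal (u z) \<partial>lebesgue) powr (s / q))
        * (\<integral>\<^sup>+y\<in>{y. r \<le> dist x y}. ennreal (k (dist x y) powr s * \<sigma> y) \<partial>lebesgue) \<le> ennreal A"
    and \<theta>: "1 / q < \<theta>" "\<theta> < 1 / p"
    and C: "C = layer_const (- \<theta> * p) (- 1) + layer_const (\<theta> * s) (s / q) * (A * 2 powr (s / q))"
    and f[measurable]: "f \<in> borel_measurable lebesgue"
    and f_norm: "(\<integral>\<^sup>+x. ennreal (\<bar>f x\<bar> powr p * \<sigma> x) \<partial>lebesgue) \<le> 1"
    and t: "0 < t"
  shows "(\<integral>\<^sup>+x\<in>{x. ennreal t < kernel_potential k (\<lambda>y. f y * \<sigma> y) x}. ennreal (u x) \<partial>lebesgue)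
    \<le> ennreal ((C / t) powr q)"
proof -
  note id_lebesgue_borel[measurable]
  interpret lebesgue: sigma_finite_measure "lebesgue :: 'a measure" by (rule sigma_finite_lebesgue)
  define \<tau> where "\<tau> = density lebesgue (\<lambda>y. ennreal (\<sigma> y))"
  have \<tau>: "sets \<tau> = sets lebesgue" "space \<tau> = UNIV" by (auto simp: \<tau>_def)
  have \<tau>_meas: "measurable \<tau> N = measurable lebesgue N" for N :: "'b measure"
    by (intro measurable_cong_sets \<tau> refl)
  have sf: "sigma_finite_measure \<tau>"
    unfolding \<tau>_def by (subst lebesgue.sigma_finite_iff_density_finite) auto
  define J where "J = kernel_potential k (\<lambda>y. f y * \<sigma> y)"
  have J_eq: "J x = (\<integral>\<^sup>+y. ennreal (k (dist x y) * \<bar>f y\<bar>) \<partial>\<tau>)" for x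
    unfolding \<tau>_def J_def kernel_potential_def using \<sigma>_nonneg k_nonneg
    by (subst nn_integral_density)
      (auto simp: ennreal_mult[symmetric] abs_mult ac_simps)
  have J_meas[measurable]: "J \<in> borel_measurable lebesgue"
    unfolding J_def kernel_potential_def by measurable
  define E where "E = {x. ennreal t < J x}"
  have E[measurable]: "E \<in> sets lebesgue"
    using borel_measurable_less[OF borel_measurable_const[of "ennreal t"] J_meas] by (simp add: E_def)
  define D where "D = density lebesgue (\<lambda>x. ennreal (u x))"
  have D_sets: "sets D = sets lebesgue" by (simp add: D_def)
  define EN where "EN = (\<lambda>N::nat. E \<inter> cball 0 (real N))"
  have EN[measurable]: "EN N \<in> sets lebesgue" for N
    unfolding EN_def by (intro sets.Int E) (simp add: fmeasurableD)
  have C0: "0 \<le> C"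
  proof -
    have "0 < s" using conj_gt_one[OF pq(1) s] by simp
    then have "s / q < \<theta> * s" "\<theta> * p < 1" using \<theta> pq by (auto simp: field_simps)
    then show ?thesis using A by (auto simp: C intro!: add_nonneg_nonneg mult_nonneg_nonneg layer_const_nonneg)
  qed
  have bound: "emeasure D (EN N) \<le> ennreal ((C / t) powr q)" for N
  proof -
    define \<mu> where "\<mu> = density lebesgue (\<lambda>x. ennreal (u x) * indicator (EN N) x)"
    have \<mu>: "sets \<mu> = sets lebesgue" "space \<mu> = UNIV" by (auto simp: \<mu>_def)
    have \<mu>_meas: "measurable \<mu> N = measurable lebesgue N" for N :: "'b measure"
      by (intro measurable_cong_sets \<mu> refl)
    have em: "emeasure \<mu> X = (\<integral>\<^sup>+x\<in>X. ennreal (u x) * indicator (EN N) x \<partial>lebesgue)"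
      if "X \<in> sets lebesgue" for X
      unfolding \<mu>_def using that by (subst emeasure_density) auto
    have D\<mu>: "emeasure D (EN N) = emeasure \<mu> UNIV"
      unfolding D_def by (subst emeasure_density) (auto simp: em)
    have "emeasure \<mu> UNIV \<le> (\<integral>\<^sup>+z\<in>cball 0 (real N). ennreal (u z) \<partial>lebesgue)"
      by (simp add: em, intro nn_integral_mono) (auto simp: EN_def indicator_def)
    also have "\<dots> < \<infinity>" by (rule u_fin)
    finally have fin: "emeasure \<mu> UNIV < \<infinity>" .
    then have finm: "finite_measure \<mu>" by (intro finite_measureI) (simp add: \<mu>)
    then interpret \<mu>: finite_measure \<mu> .
    define W where "W = measure \<mu> UNIV"
    have "emeasure \<mu> UNIV = ennreal W" by (simp add: W_def \<mu>.emeasure_eq_measure)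
    have "W \<le> (C / t) powr q"
    proof (cases "W = 0")
      case False
      then have W0: "0 < W" by (simp add: W_def less_le)
      have "ennreal (t * W) = (\<integral>\<^sup>+x. ennreal t \<partial>\<mu>)"
        using t W0 \<open>emeasure \<mu> UNIV = ennreal W\<close> by (simp add: \<mu> ennreal_mult)
      also have "\<dots> = (\<integral>\<^sup>+x. (ennreal (u x) * indicator (EN N) x) * ennreal t \<partial>lebesgue)"
        unfolding \<mu>_def by (subst nn_integral_density) auto
      also have "\<dots> \<le> (\<integral>\<^sup>+x. (ennreal (u x) * indicator (EN N) x) * J x \<partial>lebesgue)"
        by (intro nn_integral_mono) (auto simp: EN_def E_def indicator_def intro!: mult_left_mono)
      also have "\<dots> = (\<integral>\<^sup>+x. J x \<partial>\<mu>)"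
        unfolding \<mu>_def by (subst nn_integral_density) auto
      also have "\<dots> = (\<integral>\<^sup>+x. \<integral>\<^sup>+y. ennreal (k (dist x y) * \<bar>f y\<bar>) \<partial>\<tau> \<partial>\<mu>)"
        by (simp only: J_eq)
      also have "\<dots> \<le> ennreal (C * measure \<mu> UNIV powr (1 - 1 / q))"
        unfolding C
      proof (rule bilinear_form_le[OF finm sf \<mu>(2) \<tau>(2)])
        show "(\<integral>\<^sup>+y. ennreal (\<bar>f y\<bar> powr p) \<partial>\<tau>) \<le> 1"
          unfolding \<tau>_def using f_norm \<sigma>_nonneg
          by (subst nn_integral_density) (auto simp: ennreal_mult[symmetric] mult.commute)
        fix x :: 'a and r :: real assume r: "0 < r"
        \<comment> \<open>Restricting u to \<open>EN N\<close> can only decrease the masses of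
          balls, so the tail condition for u passes to \<open>\<mu>\<close> with the same A.\<close>
        have "emeasure \<mu> {z. dist x z \<le> 2 * r} = (\<integral>\<^sup>+z\<in>cball x (2 * r). ennreal (u z) * indicator (EN N) z \<partial>lebesgue)"
          using em[of "cball x (2 * r)"] by (simp add: cball_def)
        also have "\<dots> \<le> (\<integral>\<^sup>+z\<in>cball x (2 * r). ennreal (u z) \<partial>lebesgue)"
          by (intro nn_integral_mono) (auto simp: indicator_def)
        finally have "measure \<mu> {z. dist x z \<le> 2 * r}
            \<le> enn2real (\<integral>\<^sup>+z\<in>cball x (2 * r). ennreal (u z) \<partial>lebesgue)"
          unfolding measure_def using u_fin[of x "2 * r"] by (intro enn2real_mono) auto
        moreover have "0 \<le> s / q" using conj_gt_one[OF pq(1) s] pq by simp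
        ultimately have *: "ennreal (measure \<mu> {z. dist x z \<le> 2 * r} powr (s / q))
          \<le> ennreal (enn2real (\<integral>\<^sup>+z\<in>cball x (2 * r). ennreal (u z) \<partial>lebesgue) powr (s / q))"
          by (intro ennreal_leI powr_mono2) auto
        have **: "(\<integral>\<^sup>+y\<in>{y. r \<le> dist x y}. ennreal (k (dist x y) powr s) \<partial>\<tau>)
          = (\<integral>\<^sup>+y\<in>{y. r \<le> dist x y}. ennreal (k (dist x y) powr s * \<sigma> y) \<partial>lebesgue)"
        proof -
          have [measurable]: "{y. r \<le> dist x y} \<in> sets lebesgue"
            using closed_Collect_le[of "\<lambda>_. r" "dist x"] by (simp add: lborelD borel_closed continuous_intros)
          show ?thesis
            unfolding \<tau>_def using \<sigma>_nonneg
            by (subst nn_integral_density) (auto simp: ennreal_mult ac_simps intro!: nn_integral_cong)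
        qed
        show "ennreal (measure \<mu> {z. dist x z \<le> 2 * r} powr (s / q))
          * (\<integral>\<^sup>+y\<in>{y. r \<le> dist x y}. ennreal (k (dist x y) powr s) \<partial>\<tau>) \<le> ennreal A"
          unfolding ** by (rule order_trans[OF mult_right_mono[OF *] tail[OF r]]) simp
      qed (use pq s A \<theta> k_nonneg k0 W0 in \<open>auto simp: \<tau>_meas \<mu>_meas W_def\<close>)
      finally have "t * W \<le> C * W powr (1 - 1 / q)"
        using C0 by (simp add: W_def)
      also have "W powr (1 - 1 / q) = W / W powr (1 / q)"
        using W0 by (simp add: powr_diff)
      finally have "W powr (1 / q) \<le> C / t"
        using W0 t by (simp add: field_simps)
      then have "(W powr (1 / q)) powr q \<le> (C / t) powr q"
        using pq by (intro powr_mono2) auto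
      then show ?thesis using pq W0 by (simp add: powr_powr)
    qed simp
    then show ?thesis using D\<mu> \<open>emeasure \<mu> UNIV = ennreal W\<close> by (simp add: ennreal_leI)
  qed
  have UN: "(\<Union>N. EN N) = E"
  proof -
    have "\<exists>N. x \<in> cball 0 (real N)" for x :: 'a
      using real_arch_simple[of "norm x"] by (auto simp: dist_norm)
    then show ?thesis unfolding EN_def by auto
  qed
  have "(\<integral>\<^sup>+x\<in>E. ennreal (u x) \<partial>lebesgue) = emeasure D (\<Union>N. EN N)"
    unfolding D_def UN by (subst emeasure_density) auto
  also have "\<dots> = (SUP N. emeasure D (EN N))"
    by (intro SUP_emeasure_incseq[symmetric]) (auto simp: D_sets incseq_def EN_def)
  also have "\<dots> \<le> ennreal ((C / t) powr q)"
    by (intro SUP_least bound)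
  finally show ?thesis by (simp add: E_def J_def)
qed

section \<open>Bumps on concentric cubes\<close>

text \<open>The closed ball of the maximum norm; r is half the side length.\<close>

definition centered_cube :: "real ^ 'n \<Rightarrow> real \<Rightarrow> (real ^ 'n) set" where
  "centered_cube x r = cbox (\<chi> i. x $ i - r) (\<chi> i. x $ i + r)"

lemma centered_cube_in_cubes:
  assumes "0 < r" shows "centered_cube x r \<in> cubes"
  unfolding cubes_def centered_cube_def mem_Collect_eq
  using assms by (intro exI[of _ "\<chi> i. x $ i - r"] exI[of _ "2 * r"]) (simp add: add.commute)

lemma mem_centered_cube: "y \<in> centered_cube x r \<longleftrightarrow> (\<forall>i. \<bar>x $ i - y $ i\<bar> \<le> r)"
  by (auto simp: centered_cube_def mem_box_cart abs_le_iff algebra_simps)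

lemma cball_subset_centered_cube: "cball x r \<subseteq> centered_cube x r"
proof
  fix y assume "y \<in> cball x r"
  then have "norm (x - y) \<le> r" by (simp add: dist_norm)
  then show "y \<in> centered_cube x r"
    using component_le_norm_cart[of "x - y"] by (auto simp: mem_centered_cube intro: order_trans)
qed

lemma centered_cube_mono: "r \<le> r' \<Longrightarrow> centered_cube x r \<subseteq> centered_cube x r'"
  by (meson mem_centered_cube order_trans subsetI)

lemma centered_cube_sets [measurable]: "centered_cube x r \<in> sets lebesgue"
  by (simp add: centered_cube_def fmeasurableD)

lemma measure_centered_cube:
  fixes x :: "real ^ 'n"
  assumes "0 \<le> r"
  shows "measure lebesgue (centered_cube x r) = (2 * r) ^ CARD('n)"
proof -
  have "x \<in> centered_cube x r" using assms by (simp add: mem_centered_cube)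
  then have "centered_cube x r \<noteq> {}" by blast
  then show ?thesis unfolding centered_cube_def by (simp add: content_cbox_cart)
qed

lemma emeasure_centered_cube:
  fixes x :: "real ^ 'n"
  assumes "0 \<le> r"
  shows "emeasure lebesgue (centered_cube x r) = ennreal ((2 * r) ^ CARD('n))"
proof -
  have "emeasure lebesgue (centered_cube x r) = ennreal (measure lebesgue (centered_cube x r))"
    unfolding centered_cube_def by (rule emeasure_eq_measure2) simp
  then show ?thesis by (simp add: measure_centered_cube assms)
qed

section \<open>Measurability and local finiteness of weights\<close>

lemma weight_nonneg: "weight w \<Longrightarrow> 0 \<le> w x"
  by (simp add: weight_def)

text \<open>Local integrability only gives measurability of the cut-offs to balls; at each point
  these are eventually equal to w.\<close>

lemma weight_measurable:
  fixes w :: "real ^ 'n \<Rightarrow> real"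
  assumes "weight w" shows "w \<in> borel_measurable lebesgue"
proof (rule borel_measurable_LIMSEQ_real)
  fix N :: nat
  have "w absolutely_integrable_on cball 0 (real N)" using assms by (simp add: weight_def)
  then show "(\<lambda>x. indicator (cball 0 (real N)) x *\<^sub>R w x) \<in> borel_measurable lebesgue"
    unfolding set_integrable_def by (rule borel_measurable_integrable)
next
  fix x :: "real ^ 'n"
  obtain N0 where N0: "norm x \<le> real N0" using real_arch_simple by blast
  have "eventually (\<lambda>N. indicator (cball 0 (real N)) x *\<^sub>R w x = w x) sequentially"
    using eventually_ge_at_top[of N0] by eventually_elim (use N0 in auto)
  then show "(\<lambda>N. indicator (cball 0 (real N)) x *\<^sub>R w x) \<longlonglongrightarrow> w x"
    by (rule tendsto_eventually)
qed

lemma weight_nn_integral_finite: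
  assumes w: "weight w" and K: "compact K"
  shows "(\<integral>\<^sup>+x\<in>K. ennreal (w x) \<partial>lebesgue) < \<infinity>"
proof -
  have "set_integrable lebesgue K w" using assms by (auto simp: weight_def)
  then have "(\<integral>\<^sup>+x. ennreal (norm (indicator K x *\<^sub>R w x)) \<partial>lebesgue) < \<infinity>"
    unfolding set_integrable_def by (auto simp: integrable_iff_bounded)
  also have "(\<integral>\<^sup>+x. ennreal (norm (indicator K x *\<^sub>R w x)) \<partial>lebesgue) = (\<integral>\<^sup>+x\<in>K. ennreal (w x) \<partial>lebesgue)"
    using weight_nonneg[OF w] by (intro nn_integral_cong) (auto simp: indicator_def)
  finally show ?thesis .
qed

section \<open>The logarithmic gain provided by the bump\<close>

lemma loglog_bump_ge:
  assumes "1 < q" "0 \<le> \<delta>" "0 \<le> T" "T \<le> v"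
  shows "v powr q * ln (exp 1 + T) powr (q - 1) \<le> loglog_bump q \<delta> v"
proof -
  \<comment> \<open>Since ln(e^e + v) >= e, the iterated logarithm is at least 1, and so is its
    power with exponent q-1+\<delta> >= 0.\<close>
  have "exp 1 \<le> ln (exp (exp 1) + v)"
    using assms by (subst ln_ge_iff) (auto intro: add_pos_nonneg)
  then have "1 \<le> ln (ln (exp (exp 1) + v))"
    using assms by (subst ln_ge_iff) (auto intro: less_le_trans[of 0 "exp 1"])
  then have ll: "1 \<le> ln (ln (exp (exp 1) + v)) powr (q - 1 + \<delta>)"
    using assms by (intro ge_one_powr_ge_zero) auto
  have "0 \<le> ln (exp 1 + T)" using assms by (intro ln_ge_zero) (simp add: add_increasing2)
  moreover have "ln (exp 1 + T) \<le> ln (exp 1 + v)"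
    using assms by (subst ln_le_cancel_iff) (auto intro: add_pos_nonneg)
  ultimately have "ln (exp 1 + T) powr (q - 1) \<le> ln (exp 1 + v) powr (q - 1)"
    using assms by (intro powr_mono2) auto
  then have "v powr q * ln (exp 1 + T) powr (q - 1) * 1
      \<le> v powr q * ln (exp 1 + v) powr (q - 1) * ln (ln (exp (exp 1) + v)) powr (q - 1 + \<delta>)"
    using ll by (intro mult_mono) auto
  then show ?thesis by (simp add: loglog_bump_def)
qed

text \<open>Split P at the level u^(1/q) = lT. Below it u <= (lT)^q, which costs the small volume
  \<open>VP\<close>. Above it u is at most l^q \<Phi>(v) / ln(e+T)^(q-1), and the integral of
  \<Phi>(v) over Q is at most \<open>VQ\<close>, so the large volume comes with a logarithmic
  gain.\<close>

lemma mass_le_of_bump_average: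
  fixes u :: "real ^ 'n \<Rightarrow> real"
  assumes u[measurable]: "u \<in> borel_measurable lebesgue" and u_nonneg: "\<And>x. 0 \<le> u x"
    and q: "1 < q" and \<delta>: "0 \<le> \<delta>" and T: "0 \<le> T" and l: "0 < l"
    and PQ: "P \<subseteq> Q" and [measurable]: "P \<in> sets lebesgue" "Q \<in> sets lebesgue"
    and VP: "emeasure lebesgue P = ennreal VP" "0 \<le> VP"
    and VQ: "emeasure lebesgue Q = ennreal VQ" "0 < VQ"
    and avg: "average Q (\<lambda>x. ennreal (loglog_bump q \<delta> (\<bar>u x powr (1 / q)\<bar> / l))) \<le> 1"
  shows "(\<integral>\<^sup>+x\<in>P. ennreal (u x) \<partial>lebesgue)
    \<le> ennreal (l powr q * (VP * T powr q + VQ / ln (exp 1 + T) powr (q - 1)))"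
proof -
  define v where "v = (\<lambda>x. u x powr (1 / q) / l)"
  define L where "L = ln (exp 1 + T) powr (q - 1)"
  define \<Phi> where "\<Phi> = loglog_bump q \<delta>"
  have v_nonneg: "0 \<le> v x" for x using l by (simp add: v_def)
  have u_eq: "u x = l powr q * v x powr q" for x
    using l u_nonneg[of x] q by (simp add: v_def powr_divide powr_powr)
  have [measurable]: "v \<in> borel_measurable lebesgue" unfolding v_def by measurable
  have [measurable]: "(\<lambda>x. \<Phi> (v x)) \<in> borel_measurable lebesgue"
    unfolding \<Phi>_def loglog_bump_def by measurable
  have "1 < exp 1 + T" using T by (smt (verit) one_less_exp_iff)
  then have L0: "0 < L" using q by (simp add: L_def)
  have \<Phi>_nonneg: "0 \<le> \<Phi> (v x)" for x by (simp add: \<Phi>_def loglog_bump_def)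
  have int\<Phi>: "(\<integral>\<^sup>+x\<in>Q. ennreal (\<Phi> (v x)) \<partial>lebesgue) \<le> ennreal VQ"
  proof -
    have "(\<integral>\<^sup>+x\<in>Q. ennreal (\<Phi> (v x)) \<partial>lebesgue) / ennreal VQ \<le> 1"
      using avg by (simp add: average_def VQ v_def \<Phi>_def)
    then show ?thesis
      using VQ(2) by (cases "\<integral>\<^sup>+x\<in>Q. ennreal (\<Phi> (v x)) \<partial>lebesgue")
        (auto simp: divide_ennreal ennreal_top_divide top_unique split: if_splits)
  qed
  have pt: "ennreal (u x) * indicator P x \<le> ennreal (l powr q * T powr q) * indicator P x
      + ennreal (l powr q / L) * (ennreal (\<Phi> (v x)) * indicator Q x)" for x
  proof (cases "x \<in> P")
    case True
    then have "x \<in> Q" using PQ by auto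
    have "u x \<le> l powr q * T powr q + l powr q / L * \<Phi> (v x)"
    proof (cases "v x \<le> T")
      case True
      then have "v x powr q \<le> T powr q" using v_nonneg q by (intro powr_mono2) auto
      then have "u x \<le> l powr q * T powr q" unfolding u_eq by (intro mult_left_mono) auto
      moreover have "0 \<le> l powr q / L * \<Phi> (v x)" using L0 \<Phi>_nonneg by simp
      ultimately show ?thesis by linarith
    next
      case False
      then have "v x powr q * L \<le> \<Phi> (v x)"
        unfolding L_def \<Phi>_def using q \<delta> T by (intro loglog_bump_ge) auto
      then have "v x powr q \<le> \<Phi> (v x) / L" using L0 by (simp add: field_simps)
      then have "u x \<le> l powr q * (\<Phi> (v x) / L)" unfolding u_eq by (intro mult_left_mono) auto
      moreover have "0 \<le> l powr q * T powr q" by simp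
      moreover have "l powr q * (\<Phi> (v x) / L) = l powr q / L * \<Phi> (v x)" by simp
      ultimately show ?thesis by linarith
    qed
    then have "ennreal (u x) \<le> ennreal (l powr q * T powr q + l powr q / L * \<Phi> (v x))" by (rule ennreal_leI)
    also have "\<dots> = ennreal (l powr q * T powr q) + ennreal (l powr q / L) * ennreal (\<Phi> (v x))"
      using L0 \<Phi>_nonneg by (simp add: ennreal_mult[symmetric] ennreal_plus[symmetric] del: ennreal_plus)
    finally show ?thesis using True \<open>x \<in> Q\<close> by simp
  qed simp
  have "(\<integral>\<^sup>+x\<in>P. ennreal (u x) \<partial>lebesgue)
      \<le> (\<integral>\<^sup>+x. ennreal (l powr q * T powr q) * indicator P x
        + ennreal (l powr q / L) * (ennreal (\<Phi> (v x)) * indicator Q x) \<partial>lebesgue)"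
    by (rule nn_integral_mono) (rule pt)
  also have "\<dots> = ennreal (l powr q * T powr q) * emeasure lebesgue P
      + ennreal (l powr q / L) * (\<integral>\<^sup>+x\<in>Q. ennreal (\<Phi> (v x)) \<partial>lebesgue)"
    by (subst nn_integral_add) (auto simp: nn_integral_cmult nn_integral_cmult_indicator)
  also have "\<dots> \<le> ennreal (l powr q * T powr q) * ennreal VP + ennreal (l powr q / L) * ennreal VQ"
    unfolding VP(1) by (rule add_left_mono) (rule mult_left_mono[OF int\<Phi>], simp)
  also have "\<dots> = ennreal (l powr q * T powr q * VP + l powr q / L * VQ)"
    using VP VQ L0 by (simp add: ennreal_mult[symmetric] ennreal_plus[symmetric] del: ennreal_plus)
  also have "l powr q * T powr q * VP + l powr q / L * VQ = l powr q * (VP * T powr q + VQ / L)"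
    by (simp add: algebra_simps)
  finally show ?thesis unfolding L_def .
qed

text \<open>The level T = 2^(nj/(2q)) is chosen so that T^q is the square root of the volume ratio
  2^(nj). The first term is then T^(-q), exponentially small in j, while ln T grows like j and gives
  the second term the decay (1+j)^(-(q-1)).\<close>

lemma log_gain_constant:
  fixes q n :: real
  assumes q: "1 < q" and n: "0 < n"
  obtains c where "0 < c" "\<And>j::nat. 2 powr (- (n * j)) * (2 powr (n * j / (2 * q))) powr q
      + 1 / ln (exp 1 + 2 powr (n * j / (2 * q))) powr (q - 1) \<le> c * (1 + real j) powr - (q - 1)"
proof
  \<comment> \<open>Made for \<open>1 + real j \<le> a * L\<close>: the summand 1 is covered by 1 <=
    L, and j by ln T <= L.\<close>
  define a where "a = 1 + 2 * q / (n * ln 2)"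
  have a: "0 < a" using q n by (auto simp: a_def intro!: add_pos_nonneg)
  show "0 < (4 powr q + 1) * a powr (q - 1)" using a by (simp add: add_pos_pos)
  fix j :: nat
  define T where "T = 2 powr (n * j / (2 * q))"
  define L where "L = ln (exp 1 + T)"
  have T: "1 \<le> T" unfolding T_def using q n by (intro ge_one_powr_ge_zero) auto
  have L1: "1 \<le> L" unfolding L_def using T by (subst ln_ge_iff) (auto intro: add_pos_nonneg)
  have "n * j / (2 * q) * ln 2 = ln T" by (simp add: T_def)
  also have "\<dots> \<le> L" unfolding L_def using T by (subst ln_le_cancel_iff) (auto intro: add_pos_nonneg)
  finally have "real j \<le> 2 * q / (n * ln 2) * L" using q n by (simp add: field_simps)
  with L1 have aL: "1 + real j \<le> a * L" by (simp add: a_def algebra_simps)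
  \<comment> \<open>A crude comparison, from e <= 3 and T >= 1, that trades T^(-q) for a power of
    L.\<close>
  have "L \<le> exp 1 + T - 1" unfolding L_def using T by (intro ln_le_minus_one) (auto intro: add_pos_nonneg)
  also have "\<dots> \<le> 4 * T" using T exp_le by linarith
  finally have LT: "L / 4 \<le> T" by simp
  have "2 powr (- (n * j)) * T powr q = T powr - q"
    unfolding T_def powr_powr powr_add[symmetric] using q
    by (intro arg_cong[of _ _ "(powr) 2"]) (simp add: field_simps)
  also have "\<dots> \<le> (L / 4) powr - q" using LT L1 q by (intro powr_mono2') auto
  also have "\<dots> = 4 powr q * L powr - q" using L1 by (simp add: powr_divide powr_minus divide_simps)
  also have "\<dots> \<le> 4 powr q * L powr - (q - 1)" using L1 by (intro mult_left_mono powr_mono) auto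
  finally have "2 powr (- (n * j)) * T powr q + 1 / L powr (q - 1) \<le> (4 powr q + 1) * L powr - (q - 1)"
    unfolding powr_minus_divide[of L "q - 1", symmetric] distrib_right by simp
  also have "\<dots> \<le> (4 powr q + 1) * ((1 + real j) / a) powr - (q - 1)"
    using aL a q L1 by (intro mult_left_mono powr_mono2') (auto simp: field_simps)
  also have "\<dots> = (4 powr q + 1) * a powr (q - 1) * (1 + real j) powr - (q - 1)"
    unfolding powr_divide powr_minus by (simp add: divide_inverse ac_simps)
  finally show "2 powr (- (n * j)) * (2 powr (n * j / (2 * q))) powr q
      + 1 / ln (exp 1 + 2 powr (n * j / (2 * q))) powr (q - 1)
      \<le> (4 powr q + 1) * a powr (q - 1) * (1 + real j) powr - (q - 1)"
    by (simp add: T_def L_def)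
qed

section \<open>From the bump condition on cubes to the tail condition\<close>

lemma ennpowr_ennreal: "0 \<le> x \<Longrightarrow> ennpowr (ennreal x) a = ennreal (x powr a)"
  by (simp add: ennpowr_def)

lemma ennpowr_mono:
  assumes "x \<le> y" "0 \<le> a" shows "ennpowr x a \<le> ennpowr y a"
  using assms by (cases x; cases y) (auto simp: ennpowr_def top_unique intro!: ennreal_leI powr_mono2)

text \<open>With V the volume of the large cube and B the logarithmic gain, every admissible l for
  the Luxemburg norm satisfies h^(1/q) <= l (VB)^(1/q), which bounds the norm from below by the mass
  h of the small cube. Inserting this in the two-weight condition and raising to the power s
  isolates h^(s/q) \<sigma>(Q). The powers of V combine to s/q + 1 - es = s(1 - \<alpha>/n);
  \<open>e\<close> is the exponent of the condition with 1/p written as 1 - 1/s.\<close>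

lemma cube_mass_product_le:
  fixes u \<sigma> :: "real ^ 'n \<Rightarrow> real" and \<alpha> q s \<delta> K c :: real and x :: "real ^ 'n"
  defines "n \<equiv> real CARD('n)"
  defines "e \<equiv> \<alpha> / n + 1 / q - (1 - 1 / s)"
  assumes u: "weight u" and \<sigma>: "weight \<sigma>"
    and q: "1 < q" and s: "1 < s" and \<delta>: "0 \<le> \<delta>"
    and K: "0 \<le> K" "\<And>Q. Q \<in> cubes \<Longrightarrow> ennreal (measure lebesgue Q powr e)
        * luxemburg_norm (loglog_bump q \<delta>) Q (\<lambda>x. u x powr (1 / q))
        * local_norm s Q (\<lambda>x. \<sigma> x powr (1 / s)) \<le> ennreal K"
    and c: "0 < c" "2 powr (- (n * j)) * (2 powr (n * j / (2 * q))) powr q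
        + 1 / ln (exp 1 + 2 powr (n * j / (2 * q))) powr (q - 1) \<le> c * (1 + real j) powr - (q - 1)"
    and r: "0 < r"
  shows "enn2real (\<integral>\<^sup>+z\<in>centered_cube x r. ennreal (u z) \<partial>lebesgue) powr (s / q)
      * enn2real (\<integral>\<^sup>+y\<in>centered_cube x (2 ^ j * r). ennreal (\<sigma> y) \<partial>lebesgue)
    \<le> (c * (1 + real j) powr - (q - 1)) powr (s / q) * K powr s * (2 * (2 ^ j * r)) powr (s * (n - \<alpha>))"
proof -
  define P where "P = centered_cube x r"
  define Q where "Q = centered_cube x (2 ^ j * r)"
  define V where "V = (2 * (2 ^ j * r)) ^ CARD('n)"
  define T where "T = 2 powr (n * j / (2 * q))"
  define B where "B = c * (1 + real j) powr - (q - 1)"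
  define h where "h = enn2real (\<integral>\<^sup>+z\<in>P. ennreal (u z) \<partial>lebesgue)"
  define S where "S = enn2real (\<integral>\<^sup>+y\<in>Q. ennreal (\<sigma> y) \<partial>lebesgue)"
  have n: "0 < n" by (simp add: n_def)
  have V0: "0 < V" using r by (simp add: V_def)
  have B0: "0 < B" using c(1) by (simp add: B_def)
  have h_nonneg: "0 \<le> h" and S_nonneg: "0 \<le> S" by (simp_all add: h_def S_def)
  have h: "(\<integral>\<^sup>+z\<in>P. ennreal (u z) \<partial>lebesgue) = ennreal h"
    using weight_nn_integral_finite[OF u, of P] by (simp add: h_def P_def centered_cube_def)
  have S: "(\<integral>\<^sup>+y\<in>Q. ennreal (\<sigma> y) \<partial>lebesgue) = ennreal S"
    using weight_nn_integral_finite[OF \<sigma>, of Q] by (simp add: S_def Q_def centered_cube_def)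
  have PQ: "P \<subseteq> Q" unfolding P_def Q_def using r by (intro centered_cube_mono) simp
  have VQ: "emeasure lebesgue Q = ennreal V" "measure lebesgue Q = V"
    unfolding Q_def V_def using r by (intro emeasure_centered_cube measure_centered_cube; simp)+
  have VP: "emeasure lebesgue P = ennreal (V * 2 powr (- (n * j)))"
  proof -
    have "V * 2 powr (- (n * j)) = (2 * r) ^ CARD('n) * ((2 ^ j) ^ CARD('n) * 2 powr (- (n * j)))"
      by (simp add: V_def power_mult_distrib ac_simps)
    also have "((2::real) ^ j) ^ CARD('n) = 2 powr (n * j)"
      by (simp add: n_def powr_realpow[symmetric] powr_powr mult.commute)
    also have "2 powr (n * j) * 2 powr (- (n * j)) = 1"
      by (simp add: powr_add[symmetric])
    finally have "(2 * r) ^ CARD('n) = V * 2 powr (- (n * j))" by simp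
    then show ?thesis unfolding P_def using emeasure_centered_cube[of r x] r by simp
  qed
  have Qc: "Q \<in> cubes" unfolding Q_def using r by (intro centered_cube_in_cubes) simp
  define M where "M = (V * B) powr (1 / q)"
  have M0: "0 < M" using V0 B0 by (simp add: M_def)
  have adm: "h powr (1 / q) \<le> l * M"
    if l: "0 < l" "average Q (\<lambda>x. ennreal (loglog_bump q \<delta> (\<bar>u x powr (1 / q)\<bar> / l))) \<le> 1" for l
  proof -
    have "ennreal h \<le> ennreal (l powr q * (V * 2 powr (- (n * j)) * T powr q + V / ln (exp 1 + T) powr (q - 1)))"
      unfolding h[symmetric]
      using weight_measurable[OF u] weight_nonneg[OF u] V0 PQ VP VQ l q \<delta>
      by (intro mass_le_of_bump_average) (auto simp: T_def P_def Q_def)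
    also have "V * 2 powr (- (n * j)) * T powr q + V / ln (exp 1 + T) powr (q - 1)
      = V * (2 powr (- (n * j)) * T powr q + 1 / ln (exp 1 + T) powr (q - 1))"
      by (simp add: algebra_simps)
    also have "ennreal (l powr q * \<dots>) \<le> ennreal (l powr q * (V * B))"
      using c(2) V0 unfolding T_def B_def by (intro ennreal_leI mult_left_mono) auto
    finally have "h \<le> l powr q * (V * B)" using V0 B0 by simp
    then have "h powr (1 / q) \<le> (l powr q * (V * B)) powr (1 / q)"
      using h_nonneg q by (intro powr_mono2) auto
    also have "\<dots> = l * M" using l q by (simp add: powr_mult powr_powr M_def)
    finally show ?thesis .
  qed
  \<comment> \<open>A lower bound valid for every admissible l passes to the infimum, including the
    case of no admissible l, where the norm is \<infinity>.\<close>
  have lux: "ennreal (h powr (1 / q) / M) \<le> luxemburg_norm (loglog_bump q \<delta>) Q (\<lambda>x. u x powr (1 / q))"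
    unfolding luxemburg_norm_def
  proof (rule Inf_greatest, safe)
    fix l :: real
    assume l: "0 < l" "average Q (\<lambda>x. ennreal (loglog_bump q \<delta> (\<bar>u x powr (1 / q)\<bar> / l))) \<le> 1"
    from adm[OF this] show "ennreal (h powr (1 / q) / M) \<le> ennreal l"
      using M0 by (intro ennreal_leI) (simp add: field_simps)
  qed
  have loc: "local_norm s Q (\<lambda>x. \<sigma> x powr (1 / s)) = ennreal ((S / V) powr (1 / s))"
  proof -
    have "average Q (\<lambda>x. ennreal (\<bar>\<sigma> x powr (1 / s)\<bar> powr s)) = ennreal S / ennreal V"
      using s weight_nonneg[OF \<sigma>] S by (simp add: average_def VQ powr_powr)
    also have "\<dots> = ennreal (S / V)" using V0 S_nonneg by (simp add: divide_ennreal)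
    finally show ?thesis using V0 S_nonneg by (simp add: local_norm_def ennpowr_ennreal)
  qed
  have "ennreal (V powr e * (h powr (1 / q) / M) * (S / V) powr (1 / s))
      = ennreal (V powr e) * ennreal (h powr (1 / q) / M) * ennreal ((S / V) powr (1 / s))"
    using M0 by (simp add: ennreal_mult[symmetric])
  also have "\<dots> \<le> ennreal (V powr e) * luxemburg_norm (loglog_bump q \<delta>) Q (\<lambda>x. u x powr (1 / q))
      * ennreal ((S / V) powr (1 / s))"
    by (intro mult_right_mono mult_left_mono lux) auto
  also have "\<dots> \<le> ennreal K" using K(2)[OF Qc] by (simp add: VQ loc)
  finally have "V powr e * (h powr (1 / q) / M) * (S / V) powr (1 / s) \<le> K" using K(1) by simp
  then have "h powr (1 / q) * (S powr (1 / s)) \<le> M * K * (V powr (1 / s) / V powr e)"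
    using V0 M0 by (simp add: powr_divide field_simps)
  then have "(h powr (1 / q) * (S powr (1 / s))) powr s \<le> (M * K * (V powr (1 / s) / V powr e)) powr s"
    using s by (intro powr_mono2) auto
  also have "(h powr (1 / q) * (S powr (1 / s))) powr s = h powr (s / q) * S"
    using s S_nonneg by (simp add: powr_mult powr_powr)
  also have "(M * K * (V powr (1 / s) / V powr e)) powr s
      = B powr (s / q) * K powr s * (V powr (s / q) * V powr 1 / V powr (e * s))"
    using s by (simp add: powr_mult powr_powr powr_divide M_def)
  also have "V powr (s / q) * V powr 1 / V powr (e * s) = V powr (s / q + 1 - e * s)"
    unfolding powr_add powr_diff ..
  also have "s / q + 1 - e * s = s * (1 - \<alpha> / n)"
    using s by (simp add: e_def field_simps)
  also have "V powr (s * (1 - \<alpha> / n)) = (2 * (2 ^ j * r)) powr (s * (n - \<alpha>))"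
  proof -
    have "V = (2 * (2 ^ j * r)) powr n" using r by (simp add: V_def n_def powr_realpow)
    moreover have e: "n * (s * (1 - \<alpha> / n)) = s * (n - \<alpha>)" using n by (simp add: field_simps)
    ultimately show ?thesis by (simp only: powr_powr e)
  qed
  finally show ?thesis by (simp add: h_def S_def P_def Q_def B_def)
qed

text \<open>Decompose into annuli 2^j r <= |x-y| <= 2^(j+1) r: on each the kernel is at most its
  value at the inner radius, and the annulus lies in the cube whose half-side is the outer
  radius.\<close>

lemma tail_integral_le:
  fixes w :: "real ^ 'n \<Rightarrow> real" and x :: "real ^ 'n" and b :: real
  assumes [measurable]: "w \<in> borel_measurable lebesgue" and w_nonneg: "\<And>y. 0 \<le> w y"
    and r: "0 < r" and b: "0 \<le> b"
  shows "(\<integral>\<^sup>+y\<in>{y. r \<le> dist x y}. ennreal (dist x y powr - b * w y) \<partial>lebesgue)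
    \<le> (\<Sum>j. ennreal ((2 ^ j * r) powr - b)
        * (\<integral>\<^sup>+y\<in>centered_cube x (2 ^ j * (2 * r)). ennreal (w y) \<partial>lebesgue))"
proof -
  define F where "F = (\<lambda>j y. ennreal ((2 ^ j * r) powr - b)
        * (ennreal (w y) * indicator (centered_cube x (2 ^ j * (2 * r))) y))"
  have "(\<integral>\<^sup>+y\<in>{y. r \<le> dist x y}. ennreal (dist x y powr - b * w y) \<partial>lebesgue)
      \<le> (\<integral>\<^sup>+y. (\<Sum>j. F j y) \<partial>lebesgue)"
  proof (rule nn_integral_mono)
    fix y
    show "ennreal (dist x y powr - b * w y) * indicator {y. r \<le> dist x y} y \<le> (\<Sum>j. F j y)"
    proof (cases "r \<le> dist x y")
      case True
      from dyadic_layer[OF r True] obtain j :: nat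
        where "dist x y / 2 ^ j / 2 < r" "r \<le> dist x y / 2 ^ j" by blast
      then have j: "2 ^ j * r \<le> dist x y" "dist x y \<le> 2 ^ j * (2 * r)" by (simp_all add: field_simps)
      have "y \<in> centered_cube x (2 ^ j * (2 * r))"
        using j cball_subset_centered_cube[of x "2 ^ j * (2 * r)"] by (auto simp: mem_cball)
      moreover have "dist x y powr - b * w y \<le> (2 ^ j * r) powr - b * w y"
        using j b r w_nonneg by (intro mult_right_mono powr_mono2') auto
      ultimately have "ennreal (dist x y powr - b * w y) * indicator {y. r \<le> dist x y} y \<le> F j y"
        using True w_nonneg by (simp add: F_def ennreal_mult[symmetric] ennreal_leI)
      also have "\<dots> \<le> (\<Sum>j. F j y)"
        using sum_le_suminf[of "\<lambda>j. F j y" "{j}"] by simp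
      finally show ?thesis .
    qed simp
  qed
  also have "\<dots> = (\<Sum>j. \<integral>\<^sup>+y. F j y \<partial>lebesgue)"
    unfolding F_def by (rule nn_integral_suminf) measurable
  also have "\<dots> = (\<Sum>j. ennreal ((2 ^ j * r) powr - b)
        * (\<integral>\<^sup>+y\<in>centered_cube x (2 ^ j * (2 * r)). ennreal (w y) \<partial>lebesgue))"
    unfolding F_def by (intro suminf_cong nn_integral_cmult) measurable
  finally show ?thesis .
qed

text \<open>In the j-th term the kernel factor (2^j r)^(-b) cancels the power of the side 4 * 2^j r
  of the cube up to \<open>4 powr b\<close>, leaving the gain (1+j)^(-(q-1)s/q). For s = p' the
  decay exponent (q-1)s/q is p'/q', so \<open>q < s * (q - 1)\<close> is exactly the condition for
  the series to converge.\<close>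

lemma tail_condition:
  fixes u \<sigma> :: "real ^ 'n \<Rightarrow> real" and \<alpha> q s \<delta> K :: real
  defines "n \<equiv> real CARD('n)"
  assumes u: "weight u" and \<sigma>: "weight \<sigma>"
    and q: "1 < q" and s: "1 < s" "q < s * (q - 1)" and \<delta>: "0 \<le> \<delta>" and \<alpha>: "\<alpha> < n"
    and K: "0 \<le> K" "\<And>Q. Q \<in> cubes \<Longrightarrow> ennreal (measure lebesgue Q powr (\<alpha> / n + 1 / q - (1 - 1 / s)))
        * luxemburg_norm (loglog_bump q \<delta>) Q (\<lambda>x. u x powr (1 / q))
        * local_norm s Q (\<lambda>x. \<sigma> x powr (1 / s)) \<le> ennreal K"
  obtains A where "0 \<le> A" "\<And>(x :: real ^ 'n) r. 0 < r \<Longrightarrow>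
        ennreal (enn2real (\<integral>\<^sup>+z\<in>cball x (2 * r). ennreal (u z) \<partial>lebesgue) powr (s / q))
        * (\<integral>\<^sup>+y\<in>{y. r \<le> dist x y}. ennreal ((dist x y powr - (n - \<alpha>)) powr s * \<sigma> y) \<partial>lebesgue) \<le> ennreal A"
proof -
  have n: "0 < n" by (simp add: n_def)
  obtain c where c: "0 < c" "\<And>j::nat. 2 powr (- (n * j)) * (2 powr (n * j / (2 * q))) powr q
      + 1 / ln (exp 1 + 2 powr (n * j / (2 * q))) powr (q - 1) \<le> c * (1 + real j) powr - (q - 1)"
    using log_gain_constant[OF q n] by blast
  define b where "b = s * (n - \<alpha>)"
  have b: "0 \<le> b" using s \<alpha> by (simp add: b_def)
  define a where "a = (\<lambda>j::nat. (c * (1 + real j) powr - (q - 1)) powr (s / q) * K powr s * 4 powr b)"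
  have a_nonneg: "0 \<le> a j" for j by (simp add: a_def)
  have a_eq: "a j = c powr (s / q) * K powr s * 4 powr b * real (Suc j) powr - ((q - 1) * (s / q))" for j
    unfolding a_def powr_mult powr_powr minus_mult_left of_nat_Suc by simp
  have "- ((q - 1) * (s / q)) < - 1" using q s by (simp add: field_simps)
  then have "summable (\<lambda>j. real (Suc j) powr - ((q - 1) * (s / q)))"
    by (subst summable_Suc_iff) (simp add: summable_real_powr_iff)
  then have a_summable: "summable a" unfolding a_eq[abs_def] by (rule summable_mult)
  show thesis
  proof (rule that[of "\<Sum>j. a j"])
    show "0 \<le> (\<Sum>j. a j)" by (rule suminf_nonneg[OF a_summable a_nonneg])
    fix x :: "real ^ 'n" and r :: real assume r: "0 < r"
    define h where "h = enn2real (\<integral>\<^sup>+z\<in>centered_cube x (2 * r). ennreal (u z) \<partial>lebesgue)"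
    define h' where "h' = enn2real (\<integral>\<^sup>+z\<in>cball x (2 * r). ennreal (u z) \<partial>lebesgue)"
    define S where "S = (\<lambda>j::nat. \<integral>\<^sup>+y\<in>centered_cube x (2 ^ j * (2 * r)). ennreal (\<sigma> y) \<partial>lebesgue)"
    have S_fin: "S j = ennreal (enn2real (S j))" for j
      unfolding S_def using weight_nn_integral_finite[OF \<sigma>, of "centered_cube x (2 ^ j * (2 * r))"]
      by (simp add: centered_cube_def)
    have "h' \<le> h"
      unfolding h_def h'_def
    proof (rule enn2real_mono)
      show "(\<integral>\<^sup>+z\<in>cball x (2 * r). ennreal (u z) \<partial>lebesgue) \<le> (\<integral>\<^sup>+z\<in>centered_cube x (2 * r). ennreal (u z) \<partial>lebesgue)"
        using cball_subset_centered_cube[of x "2 * r"] by (intro nn_integral_mono) (auto simp: indicator_def)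
      show "(\<integral>\<^sup>+z\<in>centered_cube x (2 * r). ennreal (u z) \<partial>lebesgue) < top"
        using weight_nn_integral_finite[OF u, of "centered_cube x (2 * r)"] by (simp add: centered_cube_def)
    qed
    then have h: "ennreal (h' powr (s / q)) \<le> ennreal (h powr (s / q))"
      using s q by (intro ennreal_leI powr_mono2) (auto simp: h'_def)
    have term_le: "ennreal (h powr (s / q)) * (ennreal ((2 ^ j * r) powr - b) * S j) \<le> ennreal (a j)" for j :: nat
    proof -
      have "h powr (s / q) * enn2real (S j)
        \<le> (c * (1 + real j) powr - (q - 1)) powr (s / q) * K powr s * (2 * (2 ^ j * (2 * r))) powr b"
        unfolding h_def S_def b_def n_def
        by (rule cube_mass_product_le[OF u \<sigma> q s(1) \<delta> K(1) K(2)[unfolded n_def] c(1) c(2)[unfolded n_def]])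
          (use r in auto)
      then have "h powr (s / q) * enn2real (S j) * (2 ^ j * r) powr - b
        \<le> (c * (1 + real j) powr - (q - 1)) powr (s / q) * K powr s * (2 * (2 ^ j * (2 * r))) powr b * (2 ^ j * r) powr - b"
        by (rule mult_right_mono) simp
      also have "\<dots> = (c * (1 + real j) powr - (q - 1)) powr (s / q) * K powr s
          * ((4 * (2 ^ j * r)) powr b * (2 ^ j * r) powr - b)"
        by (simp add: ac_simps)
      also have "(4 * (2 ^ j * r)) powr b * (2 ^ j * r) powr - b = 4 powr b"
        using r by (simp add: powr_mult powr_minus field_simps)
      finally have "h powr (s / q) * enn2real (S j) * (2 ^ j * r) powr - b \<le> a j"
        by (simp add: a_def)
      then have "ennreal (h powr (s / q) * ((2 ^ j * r) powr - b * enn2real (S j))) \<le> ennreal (a j)"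
        by (intro ennreal_leI) (simp add: ac_simps)
      then show ?thesis by (subst S_fin) (simp add: ennreal_mult)
    qed
    have "ennreal (h' powr (s / q))
        * (\<integral>\<^sup>+y\<in>{y. r \<le> dist x y}. ennreal ((dist x y powr - (n - \<alpha>)) powr s * \<sigma> y) \<partial>lebesgue)
      = ennreal (h' powr (s / q)) * (\<integral>\<^sup>+y\<in>{y. r \<le> dist x y}. ennreal (dist x y powr - b * \<sigma> y) \<partial>lebesgue)"
      by (simp add: powr_powr b_def algebra_simps)
    also have "\<dots> \<le> ennreal (h powr (s / q)) * (\<Sum>j. ennreal ((2 ^ j * r) powr - b) * S j)"
      unfolding S_def
      by (intro mult_mono h tail_integral_le weight_measurable \<sigma> weight_nonneg r b) auto
    also have "\<dots> = (\<Sum>j. ennreal (h powr (s / q)) * (ennreal ((2 ^ j * r) powr - b) * S j))"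
      by simp
    also have "\<dots> \<le> (\<Sum>j. ennreal (a j))"
      by (intro suminf_le term_le summableI)
    also have "\<dots> = ennreal (\<Sum>j. a j)"
      by (rule suminf_ennreal2[OF a_nonneg a_summable])
    finally show "ennreal (enn2real (\<integral>\<^sup>+z\<in>cball x (2 * r). ennreal (u z) \<partial>lebesgue) powr (s / q))
        * (\<integral>\<^sup>+y\<in>{y. r \<le> dist x y}. ennreal ((dist x y powr - (n - \<alpha>)) powr s * \<sigma> y) \<partial>lebesgue)
        \<le> ennreal (\<Sum>j. a j)" by (simp add: h'_def)
  qed
qed

section \<open>The Riesz potential\<close>

text \<open>If a = b = \<infinity>, the difference is \<infinity> by convention, but then c =
  \<infinity> as well. Points where the Riesz potential is undefined are thus covered by the
  majorant.\<close>

lemma abs_diff_enn2ereal_le: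
  assumes "a \<le> c" "b \<le> c" shows "\<bar>enn2ereal a - enn2ereal b\<bar> \<le> enn2ereal c"
  using assms by (cases a; cases b; cases c) (auto simp: top_unique enn2ereal_ennreal)

lemma riesz_potential_le_kernel_potential:
  fixes g :: "real ^ 'n \<Rightarrow> real"
  shows "\<bar>riesz_potential \<alpha> g x\<bar> \<le> enn2ereal (kernel_potential (\<lambda>t. t powr - (real CARD('n) - \<alpha>)) g x)"
  unfolding riesz_potential_def kernel_potential_def
proof (intro abs_diff_enn2ereal_le nn_integral_mono ennreal_leI)
  fix y
  have eq: "g y / norm (x - y) powr (real CARD('n) - \<alpha>) = dist x y powr - (real CARD('n) - \<alpha>) * g y"
    unfolding divide_powr_uminus dist_norm by (rule mult.commute)
  show "g y / norm (x - y) powr (real CARD('n) - \<alpha>) \<le> dist x y powr - (real CARD('n) - \<alpha>) * \<bar>g y\<bar>"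
    "- (g y / norm (x - y) powr (real CARD('n) - \<alpha>)) \<le> dist x y powr - (real CARD('n) - \<alpha>) * \<bar>g y\<bar>"
    unfolding eq mult_minus_right[symmetric] by (intro mult_left_mono; simp)+
qed

lemma kernel_potential_scale:
  assumes k: "k \<in> borel_measurable borel" and g: "g \<in> borel_measurable lebesgue" and l: "0 \<le> l"
  shows "kernel_potential k (\<lambda>y. l * g y) x = ennreal l * kernel_potential k g x"
proof -
  note id_lebesgue_borel[measurable]
  have [measurable]: "k \<in> borel_measurable borel" "g \<in> borel_measurable lebesgue" by fact+
  have "ennreal (k (dist x y) * \<bar>l * g y\<bar>) = ennreal l * ennreal (k (dist x y) * \<bar>g y\<bar>)" for y
    using l by (subst ennreal_mult'[symmetric]) (auto simp: abs_mult ac_simps)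
  then show ?thesis
    unfolding kernel_potential_def by (simp add: nn_integral_cmult)
qed

section \<open>Assembly of the weak-type inequality\<close>

theorem theorem1p12:
  fixes \<alpha> p q :: real
  assumes "0 < \<alpha>" and "\<alpha> < real CARD('n)"
    and "1 < p" and "p \<le> q"
    and "conj_exponent p / conj_exponent q * (1 - \<alpha> / real CARD('n)) \<ge> 1"
  shows "\<exists>\<delta>0\<ge>0. \<forall>\<delta>>\<delta>0. \<forall>u \<sigma> :: real ^ 'n::finite \<Rightarrow> real.
    weight u \<and> weight \<sigma> \<and>
    (SUP Q\<in>cubes. ennreal (measure lebesgue Q powr (\<alpha> / real CARD('n) + 1 / q - 1 / p))
        * luxemburg_norm (loglog_bump q \<delta>) Q (\<lambda>x. u x powr (1 / q))
        * local_norm (conj_exponent p) Q (\<lambda>x. \<sigma> x powr (1 / conj_exponent p))) < \<infinity>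
    \<longrightarrow> (\<exists>C::real. \<forall>f \<in> Lp p \<sigma>.
          weak_Lq_norm q u (riesz_potential \<alpha> (\<lambda>y. f y * \<sigma> y)) \<le> ennreal C * Lp_norm p \<sigma> f)"
proof (rule exI[of _ 0], intro conjI allI impI order_refl)
  fix \<delta> :: real and u \<sigma> :: "real ^ 'n \<Rightarrow> real"
  define n where "n = real CARD('n)"
  define s where "s = conj_exponent p"
  define k where "k = (\<lambda>t::real. t powr - (n - \<alpha>))"
  assume \<delta>: "0 < \<delta>"
  assume "weight u \<and> weight \<sigma> \<and>
    (SUP Q\<in>cubes. ennreal (measure lebesgue Q powr (\<alpha> / real CARD('n) + 1 / q - 1 / p))
        * luxemburg_norm (loglog_bump q \<delta>) Q (\<lambda>x. u x powr (1 / q))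
        * local_norm (conj_exponent p) Q (\<lambda>x. \<sigma> x powr (1 / conj_exponent p))) < \<infinity>"
  then have u: "weight u" and \<sigma>: "weight \<sigma>" and sup:
    "(SUP Q\<in>cubes. ennreal (measure lebesgue Q powr (\<alpha> / n + 1 / q - 1 / p))
        * luxemburg_norm (loglog_bump q \<delta>) Q (\<lambda>x. u x powr (1 / q))
        * local_norm s Q (\<lambda>x. \<sigma> x powr (1 / s))) < \<infinity>"
    by (auto simp: n_def s_def)
  have q1: "1 < q" using assms by simp
  have s1: "1 < s" and ps: "1 / p + 1 / s = 1"
    using assms by (auto simp: s_def conj_exponent_def field_simps)
  \<comment> \<open>Because \<alpha> > 0, the factor 1 - \<alpha>/n is strictly below 1, so the
    exponent condition forces p'/q' > 1, the form needed for the tail series.\<close>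
  have sq: "q < s * (q - 1)"
  proof -
    have q': "0 < conj_exponent q" using q1 by (simp add: conj_exponent_def)
    have "0 < 1 - \<alpha> / n" "1 - \<alpha> / n < 1" using assms by (auto simp: n_def field_simps)
    moreover have "0 < s / conj_exponent q" using s1 q' by simp
    ultimately have "s / conj_exponent q * (1 - \<alpha> / n) < s / conj_exponent q * 1"
      by (intro mult_strict_left_mono)
    then have "1 < s / conj_exponent q" using assms(5) by (simp add: s_def n_def)
    then show ?thesis using q1 by (simp add: conj_exponent_def field_simps)
  qed
  \<comment> \<open>p' > q' is equivalent to p < q.\<close>
  have pq: "p < q"
  proof -
    have "s = p / (p - 1)" by (simp add: s_def conj_exponent_def)
    with sq have "q * (p - 1) < p * (q - 1)" using assms(3) by (simp add: field_simps)
    then show ?thesis by (simp add: algebra_simps)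
  qed
  define K where "K = enn2real (SUP Q\<in>cubes. ennreal (measure lebesgue Q powr (\<alpha> / n + 1 / q - 1 / p))
        * luxemburg_norm (loglog_bump q \<delta>) Q (\<lambda>x. u x powr (1 / q))
        * local_norm s Q (\<lambda>x. \<sigma> x powr (1 / s)))"
  have p_eq: "1 / p = 1 - 1 / s" using ps by simp
  have K: "ennreal (measure lebesgue Q powr (\<alpha> / real CARD('n) + 1 / q - (1 - 1 / s)))
        * luxemburg_norm (loglog_bump q \<delta>) Q (\<lambda>x. u x powr (1 / q))
        * local_norm s Q (\<lambda>x. \<sigma> x powr (1 / s)) \<le> ennreal K" if "Q \<in> cubes" for Q
    unfolding p_eq[symmetric] n_def[symmetric] K_def
    using sup that by (subst ennreal_enn2real) (auto intro: SUP_upper)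
  have \<alpha>n: "\<alpha> < real CARD('n)" by fact
  have K0: "0 \<le> K" by (simp add: K_def)
  obtain A where A: "0 \<le> A" "\<And>x r. 0 < r \<Longrightarrow>
        ennreal (enn2real (\<integral>\<^sup>+z\<in>cball x (2 * r). ennreal (u z) \<partial>lebesgue) powr (s / q))
        * (\<integral>\<^sup>+y\<in>{y. r \<le> dist x y}. ennreal (k (dist x y) powr s * \<sigma> y) \<partial>lebesgue) \<le> ennreal A"
    using tail_condition[OF u \<sigma> q1 s1 sq less_imp_le[OF \<delta>] \<alpha>n K0 K]
    unfolding k_def n_def by blast
  \<comment> \<open>The midpoint of the admissible interval, nonempty because p < q.\<close>
  define \<theta> where "\<theta> = (1 / p + 1 / q) / 2"
  have "1 / q < 1 / p" using pq assms(3) by (simp add: field_simps)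
  then have \<theta>: "1 / q < \<theta>" "\<theta> < 1 / p" by (auto simp: \<theta>_def)
  define C where "C = layer_const (- \<theta> * p) (- 1) + layer_const (\<theta> * s) (s / q) * (A * 2 powr (s / q))"
  have C0: "0 \<le> C"
  proof -
    have "s / q < \<theta> * s" "\<theta> * p < 1" using \<theta> q1 s1 assms(3) by (auto simp: field_simps)
    then show ?thesis using A by (auto simp: C_def intro!: add_nonneg_nonneg mult_nonneg_nonneg layer_const_nonneg)
  qed
  have k_meas: "k \<in> borel_measurable borel" unfolding k_def by measurable
  show "\<exists>C::real. \<forall>f \<in> Lp p \<sigma>.
          weak_Lq_norm q u (riesz_potential \<alpha> (\<lambda>y. f y * \<sigma> y)) \<le> ennreal C * Lp_norm p \<sigma> f"
  proof (intro exI[of _ C] ballI)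
    fix f assume "f \<in> Lp p \<sigma>"
    then have f[measurable]: "f \<in> borel_measurable lebesgue" and fin: "Lp_norm p \<sigma> f < \<infinity>"
      by (auto simp: Lp_def)
    have [measurable]: "\<sigma> \<in> borel_measurable lebesgue" by (rule weight_measurable[OF \<sigma>])
    define I where "I = enn2real (\<integral>\<^sup>+x. ennreal (\<bar>f x\<bar> powr p * \<sigma> x) \<partial>lebesgue)"
    have I0: "0 \<le> I" by (simp add: I_def)
    have I: "(\<integral>\<^sup>+x. ennreal (\<bar>f x\<bar> powr p * \<sigma> x) \<partial>lebesgue) = ennreal I"
    proof -
      have "(\<integral>\<^sup>+x. ennreal (\<bar>f x\<bar> powr p * \<sigma> x) \<partial>lebesgue) \<noteq> \<infinity>"
        using fin by (auto simp: Lp_norm_def ennpowr_def)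
      then show ?thesis by (simp add: I_def less_top)
    qed
    have norm_eq: "Lp_norm p \<sigma> f = ennreal (I powr (1 / p))"
      using I0 by (simp add: Lp_norm_def I ennpowr_ennreal)
    \<comment> \<open>The level set estimate is for functions of norm at most 1. Dividing by a
      positive l above the norm, rather than by the norm, also handles f of norm 0.\<close>
    have scaled: "weak_Lq_norm q u (riesz_potential \<alpha> (\<lambda>y. f y * \<sigma> y)) \<le> ennreal (C * l)"
      if l: "0 < l" "I powr (1 / p) \<le> l" for l
      unfolding weak_Lq_norm_def
    proof (rule SUP_least)
      fix t :: real assume "t \<in> {0<..}"
      then have t: "0 < t" by simp
      have "(I powr (1 / p)) powr p \<le> l powr p" using l assms(3) by (intro powr_mono2) auto
      then have Il: "I \<le> l powr p" using I0 assms(3) by (simp add: powr_powr)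
      have nrm: "(\<integral>\<^sup>+x. ennreal (\<bar>f x / l\<bar> powr p * \<sigma> x) \<partial>lebesgue) \<le> 1"
      proof -
        have "ennreal (\<bar>f x / l\<bar> powr p * \<sigma> x) = ennreal (1 / l powr p) * ennreal (\<bar>f x\<bar> powr p * \<sigma> x)" for x
          using l by (subst ennreal_mult'[symmetric]) (auto simp: abs_divide powr_divide)
        then have "(\<integral>\<^sup>+x. ennreal (\<bar>f x / l\<bar> powr p * \<sigma> x) \<partial>lebesgue) = ennreal (1 / l powr p) * ennreal I"
          by (simp add: nn_integral_cmult I)
        also have "\<dots> = ennreal (I / l powr p)" using I0 by (subst ennreal_mult'[symmetric]) auto
        also have "\<dots> \<le> 1" using Il l by (simp add: divide_simps)
        finally show ?thesis .
      qed
      define J where "J = kernel_potential k (\<lambda>y. f y / l * \<sigma> y)"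
      have J: "kernel_potential k (\<lambda>y. f y * \<sigma> y) x = ennreal l * J x" for x
        using kernel_potential_scale[OF k_meas, of "\<lambda>y. f y / l * \<sigma> y" l x] l by (simp add: J_def)
      have sub: "ennreal (t / l) < J x" if "ereal t < \<bar>riesz_potential \<alpha> (\<lambda>y. f y * \<sigma> y) x\<bar>" for x
      proof -
        have "ereal t < enn2ereal (ennreal l * J x)"
          using less_le_trans[OF that riesz_potential_le_kernel_potential] J[of x] by (simp add: k_def n_def)
        then have "ennreal t < ennreal l * J x"
          using t by (simp add: less_ennreal.rep_eq enn2ereal_ennreal)
        then show ?thesis
          using l t by (cases "J x") (auto simp: ennreal_mult[symmetric] ennreal_less_iff field_simps)
      qed
      \<comment> \<open>The integrands are compared pointwise, so the inclusion of the level sets is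
        all that enters.\<close>
      have "weight_measure u {x. ereal t < \<bar>riesz_potential \<alpha> (\<lambda>y. f y * \<sigma> y) x\<bar>}
          \<le> (\<integral>\<^sup>+x\<in>{x. ennreal (t / l) < J x}. ennreal (u x) \<partial>lebesgue)"
        unfolding weight_measure_def by (intro nn_integral_mono) (use sub in \<open>auto simp: indicator_def\<close>)
      also have "\<dots> \<le> ennreal ((C / (t / l)) powr q)"
        unfolding J_def
      proof (rule level_set_weight_le[where \<theta> = \<theta> and s = s and A = A and p = p])
        show "(\<integral>\<^sup>+z\<in>cball x r. ennreal (u z) \<partial>lebesgue) < \<infinity>" for x r
          by (rule weight_nn_integral_finite[OF u]) simp
      qed (use u \<sigma> weight_measurable weight_nonneg pq assms(3) ps A \<theta> C_def nrm t l k_meas in \<open>auto simp: k_def\<close>)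
      finally have "ennpowr (weight_measure u {x. ereal t < \<bar>riesz_potential \<alpha> (\<lambda>y. f y * \<sigma> y) x\<bar>}) (1 / q)
          \<le> ennpowr (ennreal ((C / (t / l)) powr q)) (1 / q)"
        using q1 by (intro ennpowr_mono) auto
      also have "\<dots> = ennreal (C * l / t)"
        using q1 C0 t l by (simp add: ennpowr_ennreal powr_powr)
      finally have "ennreal t * ennpowr (weight_measure u {x. ereal t < \<bar>riesz_potential \<alpha> (\<lambda>y. f y * \<sigma> y) x\<bar>}) (1 / q)
          \<le> ennreal t * ennreal (C * l / t)"
        by (rule mult_left_mono) simp
      also have "\<dots> = ennreal (C * l)" using t C0 l by (subst ennreal_mult'[symmetric]) auto
      finally show "ennreal t * ennpowr (weight_measure u {x. ereal t < \<bar>riesz_potential \<alpha> (\<lambda>y. f y * \<sigma> y) x\<bar>}) (1 / q)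
          \<le> ennreal (C * l)" .
    qed
    show "weak_Lq_norm q u (riesz_potential \<alpha> (\<lambda>y. f y * \<sigma> y)) \<le> ennreal C * Lp_norm p \<sigma> f"
    proof (rule ennreal_le_epsilon)
      fix e :: real assume "ennreal C * Lp_norm p \<sigma> f < top" and e: "0 < e"
      \<comment> \<open>The excess over the norm costs at most e after multiplication by C; the
        denominator C + 1 stays positive when C = 0.\<close>
      define l where "l = I powr (1 / p) + e / (C + 1)"
      have "C * (e / (C + 1)) \<le> e" using C0 e by (simp add: field_simps)
      then have "C * l \<le> C * I powr (1 / p) + e" by (simp add: l_def distrib_left)
      have "0 < e / (C + 1)" using C0 e by simp
      then have "0 < l" "I powr (1 / p) \<le> l" unfolding l_def by (auto intro: add_nonneg_pos)
      from scaled[OF this] have "weak_Lq_norm q u (riesz_potential \<alpha> (\<lambda>y. f y * \<sigma> y)) \<le> ennreal (C * l)" .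
      also have "\<dots> \<le> ennreal (C * I powr (1 / p) + e)" by (rule ennreal_leI) fact
      also have "\<dots> = ennreal C * Lp_norm p \<sigma> f + ennreal e"
        using C0 e by (simp add: norm_eq ennreal_mult)
      finally show "weak_Lq_norm q u (riesz_potential \<alpha> (\<lambda>y. f y * \<sigma> y)) \<le> ennreal C * Lp_norm p \<sigma> f + ennreal e" .
    qed
  qed
qed

end
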